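(* Let $\Omega\subset\mathbb R^d$ ($d\ge2$) be a uniformly convex domain with nodal set $\mathcal N_h=\mathcal N_h^0\cup\mathcal N_h^\partial$. Let $p$ be a convex quadratic polynomial with $\lambda I\le D^2p\le\Lambda I$, $0<\lambda\le\Lambda$, and let $p_h:=N_hp$ be the nodal function $p_h(x_i)=p(x_i)$, $x_i\in\mathcal N_h$. Let $\mathcal N_h^0$ be translation invariant and let $\mathcal T_h$ be a mesh with nodes $\mathcal N_h$ and translation invariant basis of piecewise linear hat functions $\{\phi_i\}_{i=1}^n$. Then $$|\partial p_h(x_i)|=\int_\Omega\phi_i(x)\det D^2p(x)\,dx$$ for every $x_i\in\mathcal N_h^0$ such that $\operatorname{dist}(x_i,\partial\Omega_h)\ge Rh$, where $R=\frac{\Lambda}{\lambda}\sigma^2$.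
   Context: Nodes and mesh. $\mathcal N_h=\mathcal N_h^0\cup\mathcal N_h^\partial$ is a finite set with interior nodes $\mathcal N_h^0=\{x_i\}_{i=1}^n\subset\Omega$ and boundary nodes $\mathcal N_h^\partial\subset\partial\Omega$. $\mathcal T_h$ is a conforming simplicial mesh with vertex set $\mathcal N_h$, and $\Omega_h=\bigcup_{T\in\mathcal T_h}T\subset\overline\Omega$. With $h_T=\operatorname{diam}T$, $\rho_T$ the diameter of the largest ball inscribed in $T$, and $h_i=\max\{h_T:x_i\in T\}$, it is assumed throughout that $\mathcal N_h$ is quasi-uniform ($\gamma h\le h_i\le h$ for $1\le i\le n$, with $0<\gamma\le1$, $h>0$) and shape-regular with constant $\sigma$ ($h_T/\rho_T\le\sigma$ for all $T$). Translation invariance. $\mathcal N_h^0$ is translation invariant if there is a basis $\{e_j\}_{j=1}^d$ of $\mathbb R^d$ with $|e_j|\le1$ such that $\mathcal N_h^0=\{h\sum_{j}k_je_j:k_j\in\mathbb Z\}\cap\Omega$; the boundary nodes are only required to satisfy $\partial\Omega\subset\bigcup_{x_i\in\mathcal N_h^\partial}B_{h/2}(x_i)$. The hat function $\phi_i$ is the continuous piecewise linear function over $\mathcal T_h$ equal to $1$ at $x_i$ and $0$ at all other nodes. The basis $\{\phi_i\}_{i=1}^n$ is translation invariant if $\phi_i(x+x_i)=\phi_j(x+x_j)$ for all $x\in\mathbb R^d$ whenever $x_i,x_j\in\mathcal N_h^0$ have distance $>h$ to $\partial\Omega_h$. The subdifferential of a nodal function $p_h:\mathcal N_h\to\mathbb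 R$ is $\partial p_h(x_i)=\{v\in\mathbb R^d:p_h(x_j)\ge p_h(x_i)+v\cdot(x_j-x_i)\ \forall x_j\in\mathcal N_h\}$, and $|\cdot|$ of a set is $d$-dimensional Lebesgue measure. *)

theory Defs
  imports "HOL-Analysis.Analysis"
begin

(* Uniform convexity of a bounded domain, with no smoothness of the boundary assumed: some
   R > 0 such that every boundary point lies on a sphere of radius R whose closed ball
   contains the domain.  For a C^2 boundary this says that all principal curvatures are at
   least 1 / R. *)
definition uniformly_convex_domain :: "'a::euclidean_space set \<Rightarrow> bool" where
  "uniformly_convex_domain \<Omega> \<longleftrightarrow>
     open \<Omega> \<and> \<Omega> \<noteq> {} \<and> bounded \<Omega> \<and> convex \<Omega> \<and>
     (\<exists>R>0. \<forall>z\<in>frontier \<Omega>. \<exists>y. \<Omega> \<subseteq> cball y R \<and> z \<in> sphere y R)"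

definition conforming_mesh :: "'a::euclidean_space set set \<Rightarrow> 'a set \<Rightarrow> bool" where
  "conforming_mesh \<T> N \<longleftrightarrow>
     triangulation \<T> \<and>
     (\<forall>T\<in>\<T>. int DIM('a) simplex T) \<and>
     {x. \<exists>T\<in>\<T>. x extreme_point_of T} = N"

definition inscribed_diameter :: "'a::euclidean_space set \<Rightarrow> real" where
  "inscribed_diameter T = Sup {2 * r | r. 0 \<le> r \<and> (\<exists>c. cball c r \<subseteq> T)}"

definition node_size :: "'a::euclidean_space set set \<Rightarrow> 'a \<Rightarrow> real" where
  "node_size \<T> x = Max (diameter ` {T \<in> \<T>. x \<in> T})"

definition quasi_uniform ::
    "'a::euclidean_space set set \<Rightarrow> 'a set \<Rightarrow> real \<Rightarrow> real \<Rightarrow> bool" where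
  "quasi_uniform \<T> N0 \<gamma> h \<longleftrightarrow> (\<forall>x\<in>N0. \<gamma> * h \<le> node_size \<T> x \<and> node_size \<T> x \<le> h)"

definition shape_regular :: "'a::euclidean_space set set \<Rightarrow> real \<Rightarrow> bool" where
  "shape_regular \<T> \<sigma> \<longleftrightarrow> (\<forall>T\<in>\<T>. diameter T / inscribed_diameter T \<le> \<sigma>)"

definition translation_invariant_nodes ::
    "(real ^ 'n) set \<Rightarrow> (real ^ 'n) set \<Rightarrow> (real ^ 'n) set \<Rightarrow> real \<Rightarrow> bool" where
  "translation_invariant_nodes \<Omega> N0 Nb h \<longleftrightarrow>
     (\<exists>e :: 'n \<Rightarrow> real ^ 'n.
        inj e \<and> independent (range e) \<and> span (range e) = UNIV \<and>
        (\<forall>j. norm (e j) \<le> 1) \<and>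
        N0 = {h *\<^sub>R (\<Sum>j\<in>UNIV. of_int (k j) *\<^sub>R e j) | k :: 'n \<Rightarrow> int. True} \<inter> \<Omega>) \<and>
     frontier \<Omega> \<subseteq> (\<Union>x\<in>Nb. ball x (h / 2))"

(* The hat function lives on the union of the mesh; it is extended by zero to the whole space,
   as translating it and integrating it over the domain both require. *)
definition hat_function ::
    "'a::euclidean_space set set \<Rightarrow> 'a set \<Rightarrow> 'a \<Rightarrow> ('a \<Rightarrow> real) \<Rightarrow> bool" where
  "hat_function \<T> N z \<phi> \<longleftrightarrow>
     continuous_on (\<Union>\<T>) \<phi> \<and>
     (\<forall>T\<in>\<T>. \<exists>a b. \<forall>x\<in>T. \<phi> x = a \<bullet> x + b) \<and>
     \<phi> z = 1 \<and> (\<forall>y\<in>N - {z}. \<phi> y = 0) \<and>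
     (\<forall>x. x \<notin> \<Union>\<T> \<longrightarrow> \<phi> x = 0)"

definition translation_invariant_basis ::
    "'a::euclidean_space set set \<Rightarrow> 'a set \<Rightarrow> real \<Rightarrow> ('a \<Rightarrow> 'a \<Rightarrow> real) \<Rightarrow> bool" where
  "translation_invariant_basis \<T> N0 h \<phi> \<longleftrightarrow>
     (\<forall>y\<in>N0. \<forall>z\<in>N0.
        infdist y (frontier (\<Union>\<T>)) > h \<and> infdist z (frontier (\<Union>\<T>)) > h \<longrightarrow>
        (\<forall>x. \<phi> y (x + y) = \<phi> z (x + z)))"

definition nodal_subdifferential ::
    "'a::euclidean_space set \<Rightarrow> ('a \<Rightarrow> real) \<Rightarrow> 'a \<Rightarrow> 'a set" where
  "nodal_subdifferential N u x = {v. \<forall>y\<in>N. u y \<ge> u x + v \<bullet> (y - x)}"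

definition quadratic_polynomial :: "(real ^ 'n \<Rightarrow> real) \<Rightarrow> bool" where
  "quadratic_polynomial p \<longleftrightarrow>
     (\<exists>(B :: real ^ 'n ^ 'n) b c. \<forall>x. p x = x \<bullet> (B *v x) + b \<bullet> x + c)"

definition partial_deriv :: "'n \<Rightarrow> (real ^ 'n \<Rightarrow> real) \<Rightarrow> real ^ 'n \<Rightarrow> real" where
  "partial_deriv k f x = deriv (\<lambda>t. f (x + t *\<^sub>R axis k 1)) 0"

definition hessian :: "(real ^ 'n \<Rightarrow> real) \<Rightarrow> real ^ 'n \<Rightarrow> real ^ 'n ^ 'n" where
  "hessian f x = (\<chi> k l. partial_deriv k (partial_deriv l f) x)"

definition loewner_le :: "real ^ 'n ^ 'n \<Rightarrow> real ^ 'n ^ 'n \<Rightarrow> bool" where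
  "loewner_le A B \<longleftrightarrow> (\<forall>v. v \<bullet> (A *v v) \<le> v \<bullet> (B *v v))"

end

theory Submission
  imports Defs
begin

text \<open>
  Write \<open>A\<close> for the Hessian and \<open>\<Lambda>\<close> for the lattice of nodes.  In the variable \<open>u\<close> with
  \<open>v = \<nabla>p(z) + A u\<close> the subdifferential at a deep node \<open>z\<close> is the Voronoi cell of the origin in \<open>\<Lambda>\<close>
  for the inner product given by \<open>A\<close>: constraints from lattice points outside \<open>\<Omega>\<close> and from
  boundary nodes are inactive, because \<open>R = (L / l) \<sigma>\<^sup>2\<close> and every simplex satisfies
  \<open>\<sigma>\<^sup>2 \<ge> d (d + 1) / 2\<close>.  Hence the left-hand side is \<open>det A\<close> times the volume of that cell.
  The \<open>\<Lambda>\<close>-translates of the cell tile the space, and those of \<open>\<phi> z\<close> form a partition of unity.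
  By Tonelli, any two functions whose \<open>\<Lambda>\<close>-translates sum to one have the same integral, so
  the integral of \<open>\<phi> z\<close> is the volume of the cell.
\<close>

section \<open>Shape regularity of simplices\<close>

text \<open>The edges leaving a vertex \<open>v\<close> are linearly independent, so some linear
  functional takes the value -1 on all of them. Its Riesz vector \<open>g v\<close> is the gradient
  of the barycentric coordinate of \<open>v\<close>.\<close>

lemma barycentric_gradients:
  fixes C :: "'a::euclidean_space set"
  assumes C: "\<not> affine_dependent C"
  obtains g where "\<And>x u v. \<lbrakk>v \<in> C; sum u C = 1; x = (\<Sum>w\<in>C. u w *\<^sub>R w)\<rbrakk>
                     \<Longrightarrow> u v = 1 + g v \<bullet> (x - v)"
proof -
  have fin: "finite C" using C aff_independent_finite by blast
  have "\<exists>a. \<forall>w\<in>C. a \<bullet> (w - v) = (if w = v then 0 else -1)" if v: "v \<in> C" for v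
  proof -
    have ind: "independent ((\<lambda>x. -v + x) ` (C - {v}))"
      using C v affine_dependent_iff_dependent2 by auto
    obtain f :: "'a \<Rightarrow> real" where f: "linear f"
      and fv: "\<forall>x\<in>(\<lambda>x. -v + x) ` (C - {v}). f x = -1"
      using linear_independent_extend[OF ind, of "\<lambda>_. -1"] by blast
    define a where "a = (\<Sum>b\<in>Basis. f b *\<^sub>R b)"
    have a: "f y = a \<bullet> y" for y
    proof -
      have "f y = f (\<Sum>b\<in>Basis. (y \<bullet> b) *\<^sub>R b)" by (simp add: euclidean_representation)
      also have "\<dots> = (\<Sum>b\<in>Basis. (y \<bullet> b) * f b)"
        by (simp add: linear_sum[OF f] linear_scale[OF f])
      also have "\<dots> = a \<bullet> y"
        unfolding a_def inner_sum_left by (intro sum.cong refl) (metis inner_commute inner_scaleR_left mult.commute)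
      finally show ?thesis .
    qed
    have "a \<bullet> (w - v) = (if w = v then 0 else -1)" if "w \<in> C" for w
    proof (cases "w = v")
      case False
      then have "f (-v + w) = -1" using that fv by blast
      then show ?thesis using False by (simp add: a)
    qed simp
    then show ?thesis by blast
  qed
  then obtain g where g: "\<And>v w. \<lbrakk>v \<in> C; w \<in> C\<rbrakk> \<Longrightarrow> g v \<bullet> (w - v) = (if w = v then 0 else -1)"
    by metis
  show ?thesis
  proof
    fix x u v assume v: "v \<in> C" and u: "sum u C = 1" and x: "x = (\<Sum>w\<in>C. u w *\<^sub>R w)"
    have "x - v = (\<Sum>w\<in>C. u w *\<^sub>R (w - v))"
      using u by (simp add: x scaleR_right_diff_distrib sum_subtractf flip: scaleR_left.sum)
    then have "g v \<bullet> (x - v) = (\<Sum>w\<in>C. u w * (if w = v then 0 else -1))"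
      using g v by (simp add: inner_sum_right)
    also have "\<dots> = - (\<Sum>w\<in>C - {v}. u w)"
      using fin v by (simp add: sum.remove sum_negf)
    also have "\<dots> = u v - 1" using u fin v by (simp add: sum.remove)
    finally show "u v = 1 + g v \<bullet> (x - v)" by simp
  qed
qed

text \<open>Expanding the squares turns both sides into \<open>Q - (m \<bullet> m) / W\<close>, the
  Koenig-Huygens identity. It trades distances to the weighted mean for distances between points,
  which a diameter bounds.\<close>

lemma weighted_dispersion:
  fixes C :: "'a::real_inner set" and w :: "'a \<Rightarrow> real"
  assumes fin: "finite C" and W: "sum w C = W" "W \<noteq> 0"
  shows "(\<Sum>v\<in>C. w v * (norm (v - (1 / W) *\<^sub>R (\<Sum>u\<in>C. w u *\<^sub>R u)))\<^sup>2)
       = (1 / (2 * W)) * (\<Sum>v\<in>C. \<Sum>u\<in>C. w v * w u * (norm (v - u))\<^sup>2)"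
proof -
  define m where "m = (\<Sum>u\<in>C. w u *\<^sub>R u)"
  define Q where "Q = (\<Sum>v\<in>C. w v * (v \<bullet> v))"
  have n: "(norm (a - b))\<^sup>2 = a \<bullet> a - 2 * (a \<bullet> b) + b \<bullet> b" for a b :: 'a
    by (simp add: power2_norm_eq_inner inner_diff inner_commute algebra_simps)
  have "(\<Sum>v\<in>C. w v * (norm (v - (1 / W) *\<^sub>R m))\<^sup>2)
      = Q - 2 / W * (m \<bullet> m) + W * ((1/W)\<^sup>2 * (m \<bullet> m))"
  proof -
    have "(\<Sum>v\<in>C. w v * (norm (v - (1 / W) *\<^sub>R m))\<^sup>2)
       = (\<Sum>v\<in>C. w v * (v \<bullet> v) - (2/W) * ((w v *\<^sub>R v) \<bullet> m) + w v * ((1/W)\<^sup>2 * (m \<bullet> m)))"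
      by (intro sum.cong refl, unfold n) (simp add: algebra_simps power2_eq_square)
    also have "\<dots> = Q - 2 / W * (m \<bullet> m) + W * ((1/W)\<^sup>2 * (m \<bullet> m))"
      by (simp only: sum.distrib sum_subtractf Q_def flip: sum_distrib_left sum_distrib_right inner_sum_left m_def W(1))
    finally show ?thesis .
  qed
  also have "\<dots> = Q - (m \<bullet> m) / W" using W(2) by (simp add: power2_eq_square field_simps)
  finally have 1: "(\<Sum>v\<in>C. w v * (norm (v - (1 / W) *\<^sub>R m))\<^sup>2) = Q - (m \<bullet> m) / W" .
  have in2: "(\<Sum>u\<in>C. w v * w u * (norm (v - u))\<^sup>2) = w v * (v \<bullet> v) * W - 2 * ((w v *\<^sub>R v) \<bullet> m) + w v * Q" for v
  proof -
    have "(\<Sum>u\<in>C. w v * w u * (norm (v - u))\<^sup>2)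
       = (\<Sum>u\<in>C. w v * (v \<bullet> v) * w u - 2 * ((w v *\<^sub>R v) \<bullet> (w u *\<^sub>R u)) + w v * (w u * (u \<bullet> u)))"
      by (intro sum.cong refl, unfold n) (simp add: algebra_simps)
    also have "\<dots> = w v * (v \<bullet> v) * W - 2 * ((w v *\<^sub>R v) \<bullet> m) + w v * Q"
      by (simp only: sum.distrib sum_subtractf Q_def m_def inner_sum_right flip: sum_distrib_left W(1))
    finally show ?thesis .
  qed
  have "(\<Sum>v\<in>C. \<Sum>u\<in>C. w v * w u * (norm (v - u))\<^sup>2) = Q * W - 2 * (m \<bullet> m) + W * Q"
    unfolding in2 by (simp only: sum.distrib sum_subtractf Q_def flip: sum_distrib_left sum_distrib_right inner_sum_left m_def W(1))
  then show ?thesis using 1 W(2) unfolding m_def[symmetric] by (simp add: field_simps)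
qed

text \<open>Among simplices of given diameter the regular one holds the largest ball, and it attains
  equality. The growth of the constant with the dimension is what later makes \<open>R\<close> large
  enough.\<close>

lemma simplex_inball_diameter:
  fixes T :: "'a::euclidean_space set" and r :: real
  assumes T: "int DIM('a) simplex T" and r: "0 \<le> r" and ball: "cball c r \<subseteq> T"
  shows "2 * DIM('a) * (DIM('a) + 1) * r\<^sup>2 \<le> (diameter T)\<^sup>2"
proof (cases "r = 0")
  case False
  then have r: "r > 0" using r by simp
  define d where "d = real DIM('a)"
  \<comment> \<open>\<open>g v\<close> is the gradient of the barycentric coordinate of \<open>v\<close>.
    The ball gives \<open>r * (\<Sum> norm (g v)) \<le> 1\<close>; the trace of \<open>\<Sum> g v \<otimes> v = id\<close> gives \<open>d = \<Sum> g v \<bullet> (v - m)\<close> for every \<open>m\<close>, taken as the mean of the vertices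
    with weights \<open>norm (g v)\<close>.\<close>
  obtain C where fin: "finite C" and aff: "\<not> affine_dependent C"
    and card: "int (card C) = int DIM('a) + 1" and TC: "T = convex hull C"
    using T unfolding simplex by auto
  obtain g where g: "\<And>x u v. \<lbrakk>v \<in> C; sum u C = 1; x = (\<Sum>w\<in>C. u w *\<^sub>R w)\<rbrakk>
                     \<Longrightarrow> u v = 1 + g v \<bullet> (x - v)"
    using barycentric_gradients[OF aff] by metis
  have bary: "(\<forall>v\<in>C. 0 \<le> 1 + g v \<bullet> (x - v)) \<and> (\<Sum>v\<in>C. 1 + g v \<bullet> (x - v)) = 1
      \<and> (\<Sum>v\<in>C. (1 + g v \<bullet> (x - v)) *\<^sub>R v) = x" if x: "x \<in> T" for x
  proof -
    obtain u where u: "\<forall>v\<in>C. 0 \<le> u v" "sum u C = 1" "(\<Sum>v\<in>C. u v *\<^sub>R v) = x"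
      using x unfolding TC convex_hull_finite[OF fin] by auto
    have "u v = 1 + g v \<bullet> (x - v)" if "v \<in> C" for v using g[OF that u(2)] u(3) by auto
    with u show ?thesis by (metis (no_types, lifting) sum.cong)
  qed
  have cT: "c \<in> T" using ball r by auto
  \<comment> \<open>The barycentric coordinates at \<open>c\<close> and at
    \<open>c + r *\<^sub>R b\<close> each reproduce their point and sum to one; subtracting gives
    these duality relations.\<close>
  have basis: "(\<Sum>v\<in>C. (g v \<bullet> b) *\<^sub>R v) = b" "(\<Sum>v\<in>C. g v \<bullet> b) = 0" if b: "b \<in> Basis" for b
  proof -
    have xT: "c + r *\<^sub>R b \<in> T" using ball r b by (auto simp: dist_norm)
    have eq: "1 + g v \<bullet> (c + r *\<^sub>R b - v) = (1 + g v \<bullet> (c - v)) + r * (g v \<bullet> b)" for v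
      by (simp add: inner_diff inner_add algebra_simps)
    have "r *\<^sub>R (\<Sum>v\<in>C. (g v \<bullet> b) *\<^sub>R v) = r *\<^sub>R b"
      using bary[OF xT] bary[OF cT] unfolding eq
      by (auto simp: scaleR_add_left sum.distrib scaleR_sum_right)
    then show "(\<Sum>v\<in>C. (g v \<bullet> b) *\<^sub>R v) = b" using r by simp
    have "r * (\<Sum>v\<in>C. g v \<bullet> b) = 0"
      using bary[OF xT] bary[OF cT] unfolding eq by (auto simp: sum.distrib sum_distrib_left)
    then show "(\<Sum>v\<in>C. g v \<bullet> b) = 0" using r by simp
  qed
  have sumg: "sum g C = 0"
    by (rule euclidean_eqI) (use basis in \<open>simp add: inner_sum_left\<close>)
  have trace: "(\<Sum>v\<in>C. g v \<bullet> v) = d"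
  proof -
    have "(\<Sum>v\<in>C. g v \<bullet> v) = (\<Sum>v\<in>C. \<Sum>b\<in>Basis. (g v \<bullet> b) * (v \<bullet> b))"
      by (intro sum.cong refl euclidean_inner)
    also have "\<dots> = (\<Sum>b\<in>Basis. (\<Sum>v\<in>C. (g v \<bullet> b) *\<^sub>R v) \<bullet> b)"
      by (subst sum.swap) (simp add: inner_sum_left)
    also have "\<dots> = d" using basis(1) by (simp add: d_def)
    finally show ?thesis .
  qed
  define W where "W = (\<Sum>v\<in>C. norm (g v))"
  define m where "m = (1 / W) *\<^sub>R (\<Sum>u\<in>C. norm (g u) *\<^sub>R u)"
  have dpos: "d \<ge> 1" by (simp add: d_def Suc_leI)
  have Wpos: "W > 0"
  proof -
    have "W \<ge> 0" unfolding W_def by (intro sum_nonneg) auto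
    moreover have "W \<noteq> 0"
    proof
      assume "W = 0"
      then have "\<forall>v\<in>C. g v = 0" using fin by (simp add: W_def sum_nonneg_eq_0_iff)
      then show False using trace dpos by simp
    qed
    ultimately show ?thesis by simp
  qed
  \<comment> \<open>Moving from \<open>c\<close> a distance \<open>r\<close> against
    \<open>g v\<close> lowers the coordinate of \<open>v\<close> by \<open>r * norm (g v)\<close>,
    and it stays nonnegative in the ball. The coordinates at \<open>c\<close> sum to one.\<close>
  have rW: "r * W \<le> 1"
  proof -
    have "r * norm (g v) \<le> 1 + g v \<bullet> (c - v)" if v: "v \<in> C" for v
    proof (cases "g v = 0")
      case False
      define x where "x = c - (r / norm (g v)) *\<^sub>R g v"
      have "x \<in> T" using ball r False by (auto simp: x_def dist_norm)
      then have "0 \<le> 1 + g v \<bullet> (x - v)" using bary v by blast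
      also have "\<dots> = 1 + g v \<bullet> (c - v) - r * norm (g v)"
        using False by (simp add: x_def inner_diff power2_eq_square flip: power2_norm_eq_inner)
      finally show ?thesis by simp
    qed simp
    then have "(\<Sum>v\<in>C. r * norm (g v)) \<le> (\<Sum>v\<in>C. 1 + g v \<bullet> (c - v))" by (intro sum_mono)
    then show ?thesis using bary[OF cT] by (simp add: W_def sum_distrib_left)
  qed
  have le1: "d \<le> (\<Sum>v\<in>C. norm (g v) * norm (v - m))"
  proof -
    have "d = (\<Sum>v\<in>C. g v \<bullet> (v - m))"
      using trace sumg by (simp add: inner_diff sum_subtractf flip: inner_sum_left)
    also have "\<dots> \<le> (\<Sum>v\<in>C. norm (g v) * norm (v - m))"
      by (intro sum_mono norm_cauchy_schwarz)
    finally show ?thesis .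
  qed
  \<comment> \<open>Cauchy-Schwarz, with each weight \<open>norm (g v)\<close> split into two square
    roots.\<close>
  have cs: "(\<Sum>v\<in>C. norm (g v) * norm (v - m))\<^sup>2 \<le> W * (\<Sum>v\<in>C. norm (g v) * (norm (v - m))\<^sup>2)"
  proof -
    have "(\<Sum>v\<in>C. sqrt (norm (g v)) * (sqrt (norm (g v)) * norm (v - m)))\<^sup>2
       \<le> (\<Sum>v\<in>C. (sqrt (norm (g v)))\<^sup>2) * (\<Sum>v\<in>C. (sqrt (norm (g v)) * norm (v - m))\<^sup>2)"
      by (rule Cauchy_Schwarz_ineq_sum)
    then show ?thesis by (simp add: W_def power_mult_distrib mult.assoc[symmetric])
  qed
  define D where "D = diameter T"
  have D: "norm (v - u) \<le> D" if "v \<in> C" "u \<in> C" for u v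
    using that diameter_bounded_bound[of T v u] fin
    by (auto simp: D_def TC dist_norm hull_inc finite_imp_bounded bounded_convex_hull)
  have "W * (\<Sum>v\<in>C. norm (g v) * (norm (v - m))\<^sup>2)
     = (1/2) * (\<Sum>v\<in>C. \<Sum>u\<in>C. norm (g v) * norm (g u) * (norm (v - u))\<^sup>2)"
    using weighted_dispersion[OF fin W_def[symmetric]] Wpos
    by (simp add: m_def)
  \<comment> \<open>The diagonal terms vanish; keeping them at zero instead of bounding them by
    \<open>D\<^sup>2\<close> gives the sharp constant.\<close>
  also have "\<dots> \<le> (1/2) * (\<Sum>v\<in>C. \<Sum>u\<in>C. norm (g v) * norm (g u) * (if u = v then 0 else D\<^sup>2))"
    using D by (intro mult_left_mono sum_mono) (auto intro!: mult_left_mono power_mono)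
  also have "\<dots> = (1/2) * D\<^sup>2 * (W\<^sup>2 - (\<Sum>v\<in>C. (norm (g v))\<^sup>2))"
  proof -
    have "(\<Sum>u\<in>C. norm (g v) * norm (g u) * (if u = v then 0 else D\<^sup>2)) = D\<^sup>2 * norm (g v) * (W - norm (g v))" if v: "v \<in> C" for v
    proof -
      have "(\<Sum>u\<in>C. norm (g v) * norm (g u) * (if u = v then 0 else D\<^sup>2))
         = (\<Sum>u\<in>C - {v}. D\<^sup>2 * norm (g v) * norm (g u))"
        using fin v by (simp add: sum.remove mult_ac)
      also have "\<dots> = D\<^sup>2 * norm (g v) * (W - norm (g v))"
        using fin v by (simp add: W_def sum_distrib_left sum.remove)
      finally show ?thesis .
    qed
    then have "(\<Sum>v\<in>C. \<Sum>u\<in>C. norm (g v) * norm (g u) * (if u = v then 0 else D\<^sup>2))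
        = (\<Sum>v\<in>C. D\<^sup>2 * (norm (g v) * W) - D\<^sup>2 * (norm (g v))\<^sup>2)"
      by (intro sum.cong) (auto simp: algebra_simps power2_eq_square)
    also have "\<dots> = D\<^sup>2 * (W\<^sup>2 - (\<Sum>v\<in>C. (norm (g v))\<^sup>2))"
      by (simp add: sum_subtractf W_def power2_eq_square right_diff_distrib flip: sum_distrib_left sum_distrib_right)
    finally show ?thesis by simp
  qed
  finally have up: "d\<^sup>2 \<le> (1/2) * D\<^sup>2 * (W\<^sup>2 - (\<Sum>v\<in>C. (norm (g v))\<^sup>2))"
    using cs le1 dpos power_mono[of d _ 2] by (smt (verit, best))
  \<comment> \<open>By Cauchy-Schwarz over the \<open>d + 1\<close> vertices, the diagonal carries
    at least the fraction \<open>1 / (d + 1)\<close> of \<open>W\<^sup>2\<close>.\<close>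
  have "W\<^sup>2 \<le> (d + 1) * (\<Sum>v\<in>C. (norm (g v))\<^sup>2)"
  proof -
    have "real (card C) = d + 1" using card by (simp add: d_def)
    then show ?thesis using Cauchy_Schwarz_ineq_sum[of "\<lambda>_. 1" "\<lambda>v. norm (g v)" C]
      by (simp add: W_def)
  qed
  then have X: "(d + 1) * (W\<^sup>2 - (\<Sum>v\<in>C. (norm (g v))\<^sup>2)) \<le> d * W\<^sup>2"
    by (simp add: algebra_simps)
  have "2 * (d + 1) * d\<^sup>2 \<le> 2 * (d + 1) * ((1/2) * D\<^sup>2 * (W\<^sup>2 - (\<Sum>v\<in>C. (norm (g v))\<^sup>2)))"
    using up dpos by (intro mult_left_mono) auto
  also have "\<dots> = D\<^sup>2 * ((d + 1) * (W\<^sup>2 - (\<Sum>v\<in>C. (norm (g v))\<^sup>2)))" by (simp add: field_simps)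
  also have "\<dots> \<le> D\<^sup>2 * (d * W\<^sup>2)" using X by (intro mult_left_mono) auto
  finally have "2 * (d + 1) * d\<^sup>2 \<le> D\<^sup>2 * (d * W\<^sup>2)" .
  then have "2 * (d + 1) * d \<le> D\<^sup>2 * W\<^sup>2"
    using dpos by (simp add: power2_eq_square)
  then have "r\<^sup>2 * (2 * (d + 1) * d) \<le> r\<^sup>2 * (D\<^sup>2 * W\<^sup>2)" by (intro mult_left_mono) auto
  also have "\<dots> = D\<^sup>2 * (r * W)\<^sup>2" by (simp add: power_mult_distrib)
  also have "\<dots> \<le> D\<^sup>2 * 1" using rW r Wpos
    by (intro mult_left_mono power_le_one) auto
  finally show ?thesis by (simp add: d_def D_def algebra_simps)
qed simp

text \<open>The inball estimate bounds every ball diameter in \<open>T\<close> by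
  \<open>diameter T / K\<close> with \<open>K = sqrt (d * (d + 1) / 2)\<close>, so the ratio
  controlled by \<open>\<sigma>\<close> is at least \<open>K\<close>.\<close>

lemma shape_regular_lower_bound:
  fixes \<T> :: "'a::euclidean_space set set"
  assumes "shape_regular \<T> \<sigma>" "T \<in> \<T>" and T: "int DIM('a) simplex T"
  shows "DIM('a) * (DIM('a) + 1) / 2 \<le> \<sigma>\<^sup>2"
proof -
  define d where "d = real DIM('a)"
  have d: "d \<ge> 1" by (simp add: d_def Suc_leI)
  define S where "S = {2 * r | r. 0 \<le> r \<and> (\<exists>c. cball c r \<subseteq> T)}"
  define K where "K = sqrt (d * (d + 1) / 2)"
  have K: "K > 0" "K\<^sup>2 = d * (d + 1) / 2" using d by (auto simp: K_def)
  have D0: "diameter T \<ge> 0" by (simp add: compact_simplex[OF T] compact_imp_bounded diameter_ge_0)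
  have up: "s \<le> diameter T / K" if "s \<in> S" for s
  proof -
    obtain r c where r: "s = 2 * r" "0 \<le> r" "cball c r \<subseteq> T" using \<open>s \<in> S\<close> S_def by auto
    have "(s * K)\<^sup>2 = 2 * d * (d + 1) * r\<^sup>2"
      by (simp add: power_mult_distrib K(2) r(1))
    also have "\<dots> \<le> (diameter T)\<^sup>2"
      using simplex_inball_diameter[OF T r(2,3)] by (simp add: d_def algebra_simps)
    finally have "s * K \<le> diameter T" using D0 power2_le_imp_le by blast
    then show ?thesis using K by (simp add: field_simps)
  qed
  \<comment> \<open>The inscribed diameter must be positive: a quotient by zero would be zero and
    would say nothing about \<open>\<sigma>\<close>.\<close>
  have "interior T \<noteq> {}"
  proof -
    have "aff_dim T = int DIM('a)" using aff_dim_simplex[OF T] .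
    then show ?thesis using convex_simplex[OF T]
      by (metis aff_dim_empty aff_dim_eq_full rel_interior_eq_empty rel_interior_interior of_nat_0_le_iff neg_0_le_iff_le not_one_le_zero)
  qed
  then obtain c e where e: "e > 0" "cball c e \<subseteq> T" by (meson ex_in_conv mem_interior_cball)
  then have "2 * e \<in> S" by (auto simp: S_def intro!: exI[of _ e])
  moreover have bdd: "bdd_above S" using up by (auto simp: bdd_above_def)
  ultimately have pos: "Sup S > 0" using e(1) cSup_upper[of "2 * e" S] by simp
  have "Sup S \<le> diameter T / K" using \<open>2 * e \<in> S\<close> up by (intro cSup_least) auto
  then have "K \<le> diameter T / Sup S" using K pos by (simp add: field_simps)
  also have "\<dots> \<le> \<sigma>" using assms(1,2) by (simp add: shape_regular_def inscribed_diameter_def S_def)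
  finally have "K\<^sup>2 \<le> \<sigma>\<^sup>2" using K by (intro power_mono) auto
  then show ?thesis by (simp add: K d_def algebra_simps)
qed

section \<open>Lattices and tilings\<close>

lemma nn_integral_lborel_shift:
  fixes f :: "'a::euclidean_space \<Rightarrow> ennreal"
  assumes [measurable]: "f \<in> borel_measurable borel"
  shows "(\<integral>\<^sup>+x. f (x + c) \<partial>lborel) = (\<integral>\<^sup>+x. f x \<partial>lborel)"
proof -
  have "(\<integral>\<^sup>+x. f x \<partial>lborel) = (\<integral>\<^sup>+x. f x \<partial>distr lborel borel ((+) c))"
    by (simp only: lborel_distr_plus)
  also have "\<dots> = (\<integral>\<^sup>+x. f (x + c) \<partial>lborel)"
    by (subst nn_integral_distr) (auto simp: add.commute)
  finally show ?thesis by simp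
qed

text \<open>Insert the translates of \<open>g\<close>, which sum to one, into the integral of
  \<open>f\<close>, exchange sum and integral, and shift each term by \<open>\<tau> k\<close>; now
  the translates of \<open>f\<close> sum to one. The shift is why the two hypotheses carry opposite
  signs.\<close>

lemma nn_integral_eq_if_tilings:
  fixes f g :: "'a::euclidean_space \<Rightarrow> ennreal" and \<tau> :: "'k::countable \<Rightarrow> 'a"
  assumes [measurable]: "f \<in> borel_measurable borel" "g \<in> borel_measurable borel"
    and f: "AE x in lborel. (\<integral>\<^sup>+k. f (x - \<tau> k) \<partial>count_space UNIV) = 1"
    and g: "AE x in lborel. (\<integral>\<^sup>+k. g (x + \<tau> k) \<partial>count_space UNIV) = 1"
  shows "(\<integral>\<^sup>+x. f x \<partial>lborel) = (\<integral>\<^sup>+x. g x \<partial>lborel)"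
proof -
  have "(\<integral>\<^sup>+x. f x \<partial>lborel)
      = (\<integral>\<^sup>+x. (\<integral>\<^sup>+k. f x * g (x + \<tau> k) \<partial>count_space UNIV) \<partial>lborel)"
    using g by (intro nn_integral_cong_AE) (auto simp: nn_integral_cmult)
  also have "\<dots> = (\<integral>\<^sup>+k. (\<integral>\<^sup>+x. f x * g (x + \<tau> k) \<partial>lborel) \<partial>count_space UNIV)"
    by (rule nn_integral_count_space_nn_integral) auto
  also have "\<dots> = (\<integral>\<^sup>+k. (\<integral>\<^sup>+x. f (x - \<tau> k) * g x \<partial>lborel) \<partial>count_space UNIV)"
  proof (rule nn_integral_cong)
    fix k
    show "(\<integral>\<^sup>+x. f x * g (x + \<tau> k) \<partial>lborel) = (\<integral>\<^sup>+x. f (x - \<tau> k) * g x \<partial>lborel)"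
      using nn_integral_lborel_shift[of "\<lambda>x. f (x - \<tau> k) * g x" "\<tau> k"] by simp
  qed
  also have "\<dots> = (\<integral>\<^sup>+x. (\<integral>\<^sup>+k. f (x - \<tau> k) * g x \<partial>count_space UNIV) \<partial>lborel)"
    by (rule nn_integral_count_space_nn_integral[symmetric]) auto
  also have "\<dots> = (\<integral>\<^sup>+x. g x \<partial>lborel)"
    using f by (intro nn_integral_cong_AE) (auto simp: nn_integral_multc)
  finally show ?thesis .
qed

section \<open>The lattice spanned by a basis scaled by the mesh size\<close>

locale lattice_basis =
  fixes e :: "'n \<Rightarrow> real ^ 'n" and h :: real
  assumes inj_e: "inj e" and indep: "independent (range e)" and span_e: "span (range e) = UNIV"
    and norm_e: "norm (e j) \<le> 1" and h: "0 < h"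
begin

definition lat :: "('n \<Rightarrow> int) \<Rightarrow> real ^ 'n"
  where "lat k = h *\<^sub>R (\<Sum>j\<in>UNIV. of_int (k j) *\<^sub>R e j)"

text \<open>The extension of \<open>lat\<close> to real coefficients: a linear isomorphism that
  reduces questions about the lattice to coordinates.\<close>

definition comb :: "real ^ 'n \<Rightarrow> real ^ 'n"
  where "comb t = h *\<^sub>R (\<Sum>j\<in>UNIV. (t $ j) *\<^sub>R e j)"

lemma lat_comb: "lat k = comb (\<chi> j. of_int (k j))"
  by (simp add: lat_def comb_def)

lemma linear_comb: "linear comb"
  by (rule linearI) (simp_all add: comb_def scaleR_add_left scaleR_add_right sum.distrib scaleR_sum_right mult_ac)

lemma inj_comb: "inj comb"
  unfolding linear_injective_0[OF linear_comb]
proof (intro allI impI)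
  fix t assume "comb t = 0"
  then have 0: "(\<Sum>j\<in>UNIV. (t $ j) *\<^sub>R e j) = 0" using h by (simp add: comb_def)
  have "(\<Sum>v\<in>range e. (t $ inv e v) *\<^sub>R v) = 0"
    using 0 by (simp add: sum.reindex[OF inj_e] inv_f_f[OF inj_e])
  then have "t $ inv e v = 0" if "v \<in> range e" for v
    using independentD[OF indep _ subset_refl, of "\<lambda>v. t $ inv e v" v] that by auto
  then show "t = 0" using inv_f_f[OF inj_e] by (metis rangeI vec_eq_iff zero_index)
qed

lemma surj_comb: "surj comb"
  using linear_inj_imp_surj[OF linear_comb inj_comb] .

lemma lat_zero: "lat (\<lambda>_. 0) = 0" by (simp add: lat_def)

lemma lat_add: "lat (\<lambda>j. k j + m j) = lat k + lat m"
  by (simp add: lat_def scaleR_add_left sum.distrib scaleR_add_right)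

lemma lat_uminus: "lat (\<lambda>j. - k j) = - lat k"
  by (simp add: lat_def sum_negf)

lemma lat_diff: "lat (\<lambda>j. k j - m j) = lat k - lat m"
  using lat_add[of k "\<lambda>j. - m j"] by (simp add: lat_uminus)

text \<open>An injective linear map in finite dimension is bounded below. Local finiteness and
  discreteness of the lattice both follow from this bound, since the coordinates are
  integers.\<close>

lemma lat_coordinate_bound:
  obtains B where "B > 0" "\<And>k j. \<bar>of_int (k j)\<bar> \<le> B * norm (lat k)"
proof -
  obtain B where B: "B > 0" "\<And>x. B * norm x \<le> norm (comb x)"
    using linear_inj_bounded_below_pos[OF linear_comb inj_comb] by auto
  have "\<bar>of_int (k j)\<bar> \<le> inverse B * norm (lat k)" for k :: "'n \<Rightarrow> int" and j
  proof -
    have "\<bar>of_int (k j)\<bar> \<le> norm (\<chi> j. real_of_int (k j))"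
      using component_le_norm_cart[of "\<chi> j. real_of_int (k j)" j] by simp
    then have "B * \<bar>of_int (k j)\<bar> \<le> norm (lat k)"
      using B(2)[of "\<chi> j. real_of_int (k j)"] B(1) unfolding lat_comb
      by (meson mult_left_mono order_trans less_imp_le)
    then show ?thesis using B(1) by (simp add: field_simps)
  qed
  then show ?thesis using B(1) that[of "inverse B"] by simp
qed

lemma inj_lat: "inj lat"
proof (rule injI)
  fix k m assume "lat k = lat m"
  then have "comb (\<chi> j. of_int (k j)) = comb (\<chi> j. of_int (m j))" by (simp add: lat_comb)
  then have "(\<chi> j. real_of_int (k j)) = (\<chi> j. of_int (m j))" using inj_comb by (simp add: inj_eq)
  then show "k = m" by (simp add: vec_eq_iff fun_eq_iff)
qed

lemma finite_lat_bounded: "finite {k. norm (lat k) \<le> r}"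
proof -
  obtain B where B: "B > 0" "\<And>k j. \<bar>of_int (k j)\<bar> \<le> B * norm (lat k)"
    using lat_coordinate_bound by metis
  define M where "M = \<lceil>B * r\<rceil>"
  have "{k. norm (lat k) \<le> r} \<subseteq> Pi\<^sub>E UNIV (\<lambda>_. {-M..M})"
  proof
    fix k assume "k \<in> {k. norm (lat k) \<le> r}"
    then have "B * norm (lat k) \<le> B * r" using B(1) by simp
    then have "\<bar>of_int (k j)\<bar> \<le> B * r" for j using B(2)[of k j] by linarith
    then have "\<bar>k j\<bar> \<le> M" for j
      by (metis M_def ceiling_mono ceiling_of_int of_int_abs)
    then show "k \<in> Pi\<^sub>E UNIV (\<lambda>_. {-M..M})" by (auto simp: abs_le_iff minus_le_iff)
  qed
  then show ?thesis by (rule finite_subset) (simp add: finite_PiE)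
qed

text \<open>Two lattice points closer than \<open>inverse B\<close> have integer coordinates
  differing by less than one, hence coincide; a uniformly discrete set is closed.\<close>

lemma closed_lat: "closed (range lat)"
proof -
  obtain B where B: "B > 0" "\<And>k j. \<bar>of_int (k j)\<bar> \<le> B * norm (lat k)"
    using lat_coordinate_bound by metis
  show ?thesis
  proof (rule discrete_imp_closed)
    show "0 < inverse B" using B by simp
    show "\<forall>x\<in>range lat. \<forall>y\<in>range lat. dist y x < inverse B \<longrightarrow> y = x"
    proof clarsimp
      fix k m assume d: "dist (lat m) (lat k) < inverse B"
      have "m j - k j = 0" for j
      proof -
        have "\<bar>of_int (m j - k j)\<bar> \<le> B * norm (lat m - lat k)"
          using B(2)[of "\<lambda>j. m j - k j" j] by (simp add: lat_diff)
        also have "\<dots> < 1" using d B(1) by (simp add: dist_norm field_simps)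
        finally show ?thesis by linarith
      qed
      then have "m = k" by (auto simp: fun_eq_iff)
      then show "lat m = lat k" by simp
    qed
  qed
qed

text \<open>Rounding each coordinate leaves an error of at most 1/2 along a basis vector of norm at
  most one.\<close>

lemma lat_covering_radius: "\<exists>k. norm (x - lat k) \<le> h * CARD('n) / 2"
proof -
  obtain t where t: "x = comb t" using surjD[OF surj_comb, of x] by blast
  define k where "k j = round (t $ j)" for j
  have "x - lat k = h *\<^sub>R (\<Sum>j\<in>UNIV. (t $ j - of_int (k j)) *\<^sub>R e j)"
    by (simp add: t comb_def lat_def scaleR_diff_left sum_subtractf scaleR_diff_right)
  moreover have "norm (\<Sum>j\<in>UNIV. (t $ j - of_int (k j)) *\<^sub>R e j) \<le> (\<Sum>j\<in>(UNIV::'n set). 1/2)"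
  proof (rule sum_norm_le)
    fix j :: 'n
    have "\<bar>t $ j - of_int (k j)\<bar> \<le> 1/2"
      using of_int_round_abs_le[of "t $ j"] by (simp add: k_def abs_minus_commute)
    then show "norm ((t $ j - of_int (k j)) *\<^sub>R e j) \<le> 1/2"
      using norm_e[of j] mult_mono[of _ "1/2" "norm (e j)" 1] by fastforce
  qed
  ultimately have "norm (x - lat k) \<le> h * (CARD('n) * (1/2))"
    using h by simp
  then show ?thesis by (auto simp: field_simps)
qed

end

section \<open>Voronoi cells of a lattice\<close>

text \<open>The segment from the identity to \<open>A\<close> consists of positive definite, hence
  invertible, matrices. So the determinant keeps along it the sign it has at the identity.\<close>

lemma det_pos_if_positive_definite:
  fixes A :: "real ^ 'n ^ 'n"
  assumes "\<And>v. v \<noteq> 0 \<Longrightarrow> 0 < v \<bullet> (A *v v)"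
  shows "0 < det A"
proof (rule ccontr)
  assume neg: "\<not> 0 < det A"
  define F where "F t = t *\<^sub>R A + (1 - t) *\<^sub>R mat 1" for t :: real
  have "continuous_on {0..1} (\<lambda>t. det (F t))"
    unfolding det_def F_def mat_def by (simp, intro continuous_intros)
  moreover have "det (F 0) = 1" "det (F 1) = det A" by (simp_all add: F_def)
  ultimately obtain t where t: "0 \<le> t" "t \<le> 1" "det (F t) = 0"
    using IVT2'[of "\<lambda>t. det (F t)" 1 0 0] neg by auto
  then obtain v where v: "v \<noteq> 0" "F t *v v = 0"
    using invertible_det_nz[of "F t"] matrix_left_invertible_ker[of "F t"] invertible_left_inverse[of "F t"] by auto
  have "v \<bullet> (F t *v v) = t * (v \<bullet> (A *v v)) + (1 - t) * (v \<bullet> v)"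
    by (simp add: F_def matrix_vector_mult_add_rdistrib inner_add_right scaleR_matrix_vector_assoc[symmetric])
  also have "\<dots> > 0"
    using assms[OF v(1)] v(1) t(1,2) by (cases "t = 0") (auto intro!: add_pos_nonneg mult_pos_pos)
  finally show False using v(2) by simp
qed

locale lattice_metric = lattice_basis e h for e :: "'n \<Rightarrow> real ^ 'n" and h +
  fixes A :: "real ^ 'n ^ 'n" and l L :: real
  assumes sym: "(A *v u) \<bullet> v = u \<bullet> (A *v v)"
    and l: "0 < l"
    and lower: "l * (norm v)\<^sup>2 \<le> v \<bullet> (A *v v)"
    and upper: "v \<bullet> (A *v v) \<le> L * (norm v)\<^sup>2"
begin

definition q :: "real ^ 'n \<Rightarrow> real"
  where "q v = v \<bullet> (A *v v)"

text \<open>Each constraint is \<open>q u \<le> q (u - lat k)\<close> with \<open>q u\<close>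
  cancelled, so the cell appears as an intersection of half-spaces.\<close>

definition voronoi :: "(real ^ 'n) set"
  where "voronoi = {u. \<forall>k. 2 * (u \<bullet> (A *v lat k)) \<le> q (lat k)}"

lemma q_nonneg: "0 \<le> q v"
  using lower[of v] l by (smt (verit) q_def zero_le_mult_iff zero_le_power2)

lemma q_pos: "v \<noteq> 0 \<Longrightarrow> 0 < q v"
  using lower[of v] l by (smt (verit) q_def mult_pos_pos zero_less_norm_iff zero_less_power)

lemma q_add: "q (u + v) = q u + 2 * (u \<bullet> (A *v v)) + q v"
  using sym[of u v] by (simp add: q_def matrix_vector_right_distrib inner_add inner_commute[of v])

lemma q_scale: "q (c *\<^sub>R v) = c\<^sup>2 * q v"
  by (simp add: q_def matrix_vector_mult_scaleR power2_eq_square)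

lemma q_uminus: "q (- v) = q v"
  using q_scale[of "-1" v] by simp

lemma q_diff: "q (u - v) = q u - 2 * (u \<bullet> (A *v v)) + q v"
  using q_add[of u "- v"] q_uminus[of v] matrix_vector_mult_scaleR[of A "-1" v] by simp

text \<open>This is \<open>0 \<le> q (2 *\<^sub>R u - v)\<close> expanded. In particular, if
  \<open>4 * q u \<le> q v\<close>, then \<open>u\<close> satisfies the cell constraint of
  \<open>v\<close>.\<close>

lemma inner_le_q: "4 * (u \<bullet> (A *v v)) \<le> 4 * q u + q v"
  using q_nonneg[of "2 *\<^sub>R u - v"] q_diff[of "2 *\<^sub>R u" v] q_scale[of 2 u] by simp

lemma det_pos: "0 < det A"
  by (rule det_pos_if_positive_definite) (use q_pos in \<open>simp add: q_def\<close>)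

lemma finite_lat_q: "finite {k. q (x + lat k) \<le> r}"
proof (rule finite_subset[OF _ finite_lat_bounded])
  show "{k. q (x + lat k) \<le> r} \<subseteq> {k. norm (lat k) \<le> norm x + sqrt (r / l)}"
  proof clarsimp
    fix k assume "q (x + lat k) \<le> r"
    then have "l * (norm (x + lat k))\<^sup>2 \<le> r" using lower[of "x + lat k"] by (simp add: q_def)
    then have "(norm (x + lat k))\<^sup>2 \<le> r / l" using l by (simp add: field_simps)
    then have "norm (x + lat k) \<le> sqrt (r / l)" by (rule real_le_rsqrt)
    then show "norm (lat k) \<le> norm x + sqrt (r / l)"
      using norm_triangle_ineq4[of "x + lat k" x] by simp
  qed
qed

text \<open>A translate of \<open>x\<close> with least \<open>q\<close> lies in the cell. It exists
  because only finitely many translates do no worse than \<open>x\<close> itself.\<close>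

lemma voronoi_covers: "\<exists>k. x + lat k \<in> voronoi"
proof -
  define S where "S = {k. q (x + lat k) \<le> q x}"
  have S: "finite S" "(\<lambda>_. 0) \<in> S"
    using finite_lat_q by (auto simp: S_def lat_zero)
  obtain k where k: "k \<in> S" "\<And>m. m \<in> S \<Longrightarrow> q (x + lat k) \<le> q (x + lat m)"
    using arg_min_if_finite[OF S(1), of "\<lambda>k. q (x + lat k)"] S(2)
    by (metis empty_iff leI)
  have min: "q (x + lat k) \<le> q (x + lat m)" for m
    using k by (cases "m \<in> S") (auto simp: S_def)
  have "2 * ((x + lat k) \<bullet> (A *v lat m)) \<le> q (lat m)" for m
    using min[of "\<lambda>j. k j - m j"] q_diff[of "x + lat k" "lat m"] by (simp add: lat_diff algebra_simps)
  then show ?thesis unfolding voronoi_def by blast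
qed

text \<open>With \<open>y = lat m - lat k\<close>, the constraint of \<open>- y\<close> at the first
  point and that of \<open>y\<close> at the second bound the same quantity from below and from
  above. Overlaps therefore lie in hyperplanes.\<close>

lemma voronoi_overlap:
  assumes "x + lat k \<in> voronoi" "x + lat m \<in> voronoi"
  shows "2 * ((x + lat k) \<bullet> (A *v (lat m - lat k))) = - q (lat m - lat k)"
proof -
  define y where "y = lat m - lat k"
  have "2 * ((x + lat k) \<bullet> (A *v (- y))) \<le> q (- y)"
    using assms(1) unfolding voronoi_def y_def by (auto dest: spec[of _ "\<lambda>j. k j - m j"] simp: lat_diff)
  moreover have "2 * ((x + lat k + y) \<bullet> (A *v y)) \<le> q y"
    using assms(2) unfolding voronoi_def y_def by (auto dest: spec[of _ "\<lambda>j. m j - k j"] simp: lat_diff)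
  moreover have "A *v (- y) = - (A *v y)" using matrix_vector_mult_scaleR[of A "-1" y] by simp
  ultimately show ?thesis
    by (simp add: y_def[symmetric] q_uminus inner_add_left q_def[of y])
qed

text \<open>Some translate always hits the cell, and two can do so only on one of countably many
  hyperplanes, whose union is null.\<close>

lemma voronoi_tiling:
  "AE x in lborel. (\<integral>\<^sup>+k. indicator voronoi (x + lat k) \<partial>count_space UNIV) = (1::ennreal)"
proof -
  define H where "H k m = {x. (A *v (lat m - lat k)) \<bullet> x
      = - q (lat m - lat k) / 2 - lat k \<bullet> (A *v (lat m - lat k))}" for k m
  have "negligible (H k m)" if "k \<noteq> m" for k m
  proof -
    have "lat m - lat k \<noteq> 0" using that inj_lat by (auto dest: injD)
    then have "A *v (lat m - lat k) \<noteq> 0" using q_pos[of "lat m - lat k"] by (auto simp: q_def)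
    then show ?thesis unfolding H_def by (intro negligible_hyperplane) auto
  qed
  then have neg: "negligible (\<Union>p\<in>{p. fst p \<noteq> snd p}. H (fst p) (snd p))"
    by (intro negligible_countable_Union) auto
  then have "AE x in lebesgue. x \<notin> (\<Union>p\<in>{p. fst p \<noteq> snd p}. H (fst p) (snd p))"
    by (intro AE_not_in) (simp only: negligible_iff_null_sets)
  then have "AE x in lborel. x \<notin> (\<Union>p\<in>{p. fst p \<noteq> snd p}. H (fst p) (snd p))"
    by (simp add: AE_completion_iff)
  then show ?thesis
  proof eventually_elim
    case (elim x)
    obtain k where k: "x + lat k \<in> voronoi" using voronoi_covers by blast
    have "x + lat m \<notin> voronoi" if "m \<noteq> k" for m
    proof
      assume "x + lat m \<in> voronoi"
      from voronoi_overlap[OF k this] have "x \<in> H k m"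
        by (simp add: H_def inner_add_left inner_commute[of x])
      with elim that show False by force
    qed
    then have "(\<integral>\<^sup>+k. indicator voronoi (x + lat k) \<partial>count_space UNIV)
        = (\<Sum>m\<in>{k}. indicator voronoi (x + lat m) :: ennreal)"
      by (intro nn_integral_count_space') auto
    then show ?case using k by simp
  qed
qed

text \<open>In the metric \<open>q\<close>, a point of the cell is no farther from the origin than
  from the lattice point given by the covering radius.\<close>

lemma voronoi_q_le:
  assumes "u \<in> voronoi" shows "4 * q u \<le> L * (h * CARD('n))\<^sup>2"
proof -
  obtain k where k: "norm (u - lat k) \<le> h * CARD('n) / 2" using lat_covering_radius by blast
  have "0 < L"
  proof -
    have "l \<le> L" using lower[of "axis undefined 1"] upper[of "axis undefined 1"] by simp
    then show ?thesis using l by simp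
  qed
  have "q u \<le> q (u - lat k)" using assms q_diff[of u "lat k"] by (auto simp: voronoi_def)
  also have "\<dots> \<le> L * (norm (u - lat k))\<^sup>2" unfolding q_def by (rule upper)
  also have "\<dots> \<le> L * (h * CARD('n) / 2)\<^sup>2"
    using k \<open>0 < L\<close> by (intro mult_left_mono power_mono) auto
  finally show ?thesis by (simp add: power_divide)
qed

lemma compact_voronoi: "compact voronoi"
  unfolding compact_eq_bounded_closed
proof
  have "voronoi = (\<Inter>k. {u. 2 * (u \<bullet> (A *v lat k)) \<le> q (lat k)})" by (auto simp: voronoi_def)
  also have "closed \<dots>" by (intro closed_INT ballI closed_Collect_le continuous_intros)
  finally show "closed voronoi" .
  show "bounded voronoi"
  proof (rule boundedI)
    fix u assume "u \<in> voronoi"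
    then have "l * (norm u)\<^sup>2 \<le> L * (h * CARD('n))\<^sup>2 / 4"
      using voronoi_q_le[of u] lower[of u] by (simp add: q_def)
    then have "(norm u)\<^sup>2 \<le> (L * (h * CARD('n))\<^sup>2 / 4) / l" using l by (simp add: field_simps)
    then show "norm u \<le> sqrt ((L * (h * CARD('n))\<^sup>2 / 4) / l)" by (rule real_le_rsqrt)
  qed
qed

text \<open>Here \<open>4 * q u \<le> q y\<close>, so \<open>inner_le_q\<close> applies. The vector
  \<open>y\<close> is arbitrary because boundary nodes may lie off the lattice.\<close>

lemma voronoi_far:
  assumes R: "L * (CARD('n))\<^sup>2 \<le> l * R\<^sup>2" "0 \<le> R" and u: "u \<in> voronoi" and y: "R * h \<le> norm y"
  shows "2 * (u \<bullet> (A *v y)) \<le> q y"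
proof -
  have "4 * q u \<le> (L * (CARD('n))\<^sup>2) * h\<^sup>2"
    using voronoi_q_le[OF u] by (simp add: power_mult_distrib mult_ac)
  also have "\<dots> \<le> l * R\<^sup>2 * h\<^sup>2" using R(1) by (intro mult_right_mono) auto
  also have "\<dots> = l * (R * h)\<^sup>2" by (simp add: power_mult_distrib)
  also have "\<dots> \<le> l * (norm y)\<^sup>2" using R(2) h l y by (intro mult_left_mono power_mono) auto
  also have "\<dots> \<le> q y" using lower by (simp add: q_def)
  finally show ?thesis using inner_le_q[of u y] by linarith
qed

text \<open>Lattice points at distance \<open>R * h\<close> or more may miss the domain and then are
  not nodes, so the cell must be recovered from short vectors alone. Strictness of the bound on
  \<open>R\<close> excludes a binding vector of length exactly \<open>R * h\<close>.\<close>

lemma voronoi_local: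
  assumes R: "L * (CARD('n))\<^sup>2 < l * R\<^sup>2" "0 \<le> R"
    and u: "\<And>k. norm (lat k) < R * h \<Longrightarrow> 2 * (u \<bullet> (A *v lat k)) \<le> q (lat k)"
  shows "u \<in> voronoi"
proof (rule ccontr)
  assume "u \<notin> voronoi"
  define Y where "Y = {k. q (lat k) < 2 * (u \<bullet> (A *v lat k))}"
  have "Y \<noteq> {}" using \<open>u \<notin> voronoi\<close> by (auto simp: Y_def voronoi_def not_le)
  \<comment> \<open>By \<open>inner_le_q\<close>, a violated constraint forces
    \<open>q (lat k) \<le> 4 * q u\<close>.\<close>
  moreover have "finite Y"
  proof (rule finite_subset[OF _ finite_lat_q[of 0 "4 * q u"]])
    show "Y \<subseteq> {k. q (0 + lat k) \<le> 4 * q u}"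
    proof
      fix k assume "k \<in> Y"
      then show "k \<in> {k. q (0 + lat k) \<le> 4 * q u}" using inner_le_q[of u "lat k"] by (simp add: Y_def)
    qed
  qed
  \<comment> \<open>The first constraint met on the ray through \<open>u\<close>: \<open>s k *\<^sub>R u\<close> lies in the cell, so \<open>lat k\<close> is short.\<close>
  moreover define s where "s k = q (lat k) / (2 * (u \<bullet> (A *v lat k)))" for k
  ultimately obtain k where k: "k \<in> Y" "\<And>m. m \<in> Y \<Longrightarrow> s k \<le> s m"
    using arg_min_if_finite[of Y s] by (metis leI)
  have pos: "0 < u \<bullet> (A *v lat m)" if "m \<in> Y" for m
    using that q_nonneg[of "lat m"] by (simp add: Y_def)
  have s: "0 \<le> s k" "s k \<le> 1"
    using k(1) pos[OF k(1)] q_nonneg[of "lat k"] by (auto simp: s_def Y_def)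
  \<comment> \<open>Violated constraints are repaired because \<open>s k\<close> is the least of
    their ratios; satisfied ones survive scaling by a factor in [0, 1], as \<open>q (lat m)\<close>
    is nonnegative.\<close>
  have "2 * ((s k *\<^sub>R u) \<bullet> (A *v lat m)) \<le> q (lat m)" for m
  proof (cases "m \<in> Y")
    case True
    then show ?thesis using k(2)[OF True] pos[OF True] by (simp add: s_def[of m] field_simps)
  next
    case False
    then have m: "2 * (u \<bullet> (A *v lat m)) \<le> q (lat m)" by (simp add: Y_def)
    show ?thesis
    proof (cases "0 \<le> u \<bullet> (A *v lat m)")
      case True
      then have "s k * (u \<bullet> (A *v lat m)) \<le> u \<bullet> (A *v lat m)" using s by (simp add: mult_left_le_one_le)
      then show ?thesis using m by simp
    next
      case False
      then have "s k * (u \<bullet> (A *v lat m)) \<le> 0" using s by (simp add: mult_nonneg_nonpos)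
      then show ?thesis using q_nonneg[of "lat m"] by simp
    qed
  qed
  then have sV: "s k *\<^sub>R u \<in> voronoi" by (simp add: voronoi_def)
  have "norm (lat k) < R * h"
  proof (rule ccontr)
    assume "\<not> norm (lat k) < R * h"
    have "q (lat k) = 2 * ((s k *\<^sub>R u) \<bullet> (A *v lat k))"
      using pos[OF k(1)] by (simp add: s_def)
    then have "q (lat k) \<le> 4 * q (s k *\<^sub>R u)" using inner_le_q[of "s k *\<^sub>R u" "lat k"] by simp
    also have "\<dots> \<le> (L * (CARD('n))\<^sup>2) * h\<^sup>2"
      using voronoi_q_le[OF sV] by (simp add: power_mult_distrib mult_ac)
    also have "\<dots> < (l * R\<^sup>2) * h\<^sup>2" using R(1) h by (intro mult_strict_right_mono) auto
    also have "\<dots> = l * (R * h)\<^sup>2" by (simp add: power_mult_distrib)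
    also have "\<dots> \<le> l * (norm (lat k))\<^sup>2"
      using R(2) h l \<open>\<not> norm (lat k) < R * h\<close> by (intro mult_left_mono power_mono) auto
    also have "\<dots> \<le> q (lat k)" using lower by (simp add: q_def)
    finally show False by simp
  qed
  then show False using u[of k] k(1) by (simp add: Y_def)
qed

end

section \<open>Hat functions\<close>

text \<open>The node is a vertex of some \<open>T'\<close>, and \<open>T \<inter> T'\<close> is a
  face of both simplices; extremality passes from \<open>T'\<close> to the common face and from
  there to \<open>T\<close>. Thus there are no hanging nodes.\<close>

lemma conforming_mesh_node_extreme:
  assumes "conforming_mesh \<T> N" "T \<in> \<T>" "y \<in> N" "y \<in> T"
  shows "y extreme_point_of T"
proof -
  obtain T' where T': "T' \<in> \<T>" "y extreme_point_of T'"
    using assms(1,3) by (auto simp: conforming_mesh_def)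
  have "T' \<inter> T face_of T'" "T \<inter> T' face_of T"
    using assms(1,2) T'(1) by (auto simp: conforming_mesh_def triangulation_def)
  then show ?thesis
    using T'(2) assms(4) extreme_point_of_face[of "T' \<inter> T" T' y] extreme_point_of_face[of "T \<inter> T'" T y]
    by (auto simp: Int_commute extreme_point_of_def)
qed

lemma conforming_mesh_simplex_hull:
  assumes "conforming_mesh \<T> N" "T \<in> \<T>"
  shows "T = convex hull (N \<inter> T)"
proof -
  obtain C where C: "\<not> affine_dependent C" "T = convex hull C"
    using assms by (auto simp: conforming_mesh_def simplex_def)
  have "y \<in> C \<longleftrightarrow> y extreme_point_of T" for y
    using C by (simp add: extreme_point_of_convex_hull_affine_independent)
  moreover have "y extreme_point_of T \<longleftrightarrow> y \<in> N \<inter> T" for y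
    using conforming_mesh_node_extreme[OF assms] assms
    by (auto simp: conforming_mesh_def extreme_point_of_def)
  ultimately have "C = N \<inter> T" by blast
  then show ?thesis using C(2) by simp
qed

lemma mesh_coordinates:
  assumes "conforming_mesh \<T> N" "finite N" "T \<in> \<T>" "x \<in> T"
  obtains u where "\<forall>v\<in>N \<inter> T. 0 \<le> u v" "sum u (N \<inter> T) = 1" "(\<Sum>v\<in>N \<inter> T. u v *\<^sub>R v) = x"
proof -
  have eq: "convex hull (N \<inter> T) = T" using conforming_mesh_simplex_hull[OF assms(1,3)] by (rule sym)
  have "x \<in> convex hull (N \<inter> T)" unfolding eq by (rule assms(4))
  then show ?thesis using assms(2) that by (auto simp: convex_hull_finite)
qed

text \<open>An affine function commutes with affine combinations, and the nodal values of
  \<open>\<phi>\<close> select the weight of \<open>y\<close>.\<close>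

lemma hat_function_coordinate:
  assumes "hat_function \<T> N y \<phi>" "finite N" "T \<in> \<T>" "y \<in> N"
    and u: "sum u (N \<inter> T) = 1" "(\<Sum>v\<in>N \<inter> T. u v *\<^sub>R v) = x" and x: "x \<in> T"
  shows "\<phi> x = (if y \<in> T then u y else 0)"
proof -
  have "\<exists>a b. \<forall>x\<in>T. \<phi> x = a \<bullet> x + b"
    using assms(1,3) by (simp add: hat_function_def)
  then obtain a b where ab: "\<And>x. x \<in> T \<Longrightarrow> \<phi> x = a \<bullet> x + b" by metis
  have "\<phi> x = (\<Sum>v\<in>N \<inter> T. u v * (a \<bullet> v)) + b * sum u (N \<inter> T)"
    unfolding ab[OF x] u(1) unfolding u(2)[symmetric] by (simp add: inner_sum_right)
  also have "\<dots> = (\<Sum>v\<in>N \<inter> T. u v * \<phi> v)"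
    using ab by (simp add: sum_distrib_left distrib_left mult.commute flip: sum.distrib)
  also have "\<dots> = (\<Sum>v\<in>N \<inter> T. if v = y then u y else 0)"
    using assms(1) by (intro sum.cong) (auto simp: hat_function_def)
  also have "\<dots> = (if y \<in> T then u y else 0)" using assms(2,4) by simp
  finally show ?thesis .
qed

lemma hat_function_nonneg:
  assumes "conforming_mesh \<T> N" "finite N" "hat_function \<T> N y \<phi>" "y \<in> N"
  shows "0 \<le> \<phi> x"
proof (cases "x \<in> \<Union>\<T>")
  case True
  then obtain T where T: "T \<in> \<T>" "x \<in> T" by blast
  obtain u where u: "\<forall>v\<in>N \<inter> T. 0 \<le> u v" "sum u (N \<inter> T) = 1" "(\<Sum>v\<in>N \<inter> T. u v *\<^sub>R v) = x"
    using mesh_coordinates[OF assms(1,2) T] .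
  show ?thesis using hat_function_coordinate[OF assms(3,2) T(1) assms(4) u(2,3) T(2)] u(1) assms(4) by simp
qed (use assms(3) in \<open>simp add: hat_function_def\<close>)

lemma hat_function_off_star:
  assumes "conforming_mesh \<T> N" "finite N" "hat_function \<T> N y \<phi>" "y \<in> N"
    and "T \<in> \<T>" "x \<in> T" "y \<notin> T"
  shows "\<phi> x = 0"
proof -
  obtain u where u: "\<forall>v\<in>N \<inter> T. 0 \<le> u v" "sum u (N \<inter> T) = 1" "(\<Sum>v\<in>N \<inter> T. u v *\<^sub>R v) = x"
    using mesh_coordinates[OF assms(1,2,5,6)] .
  show ?thesis using hat_function_coordinate[OF assms(3,2,5,4) u(2,3) assms(6)] assms(7) by simp
qed

text \<open>On \<open>T\<close> the hat functions are the barycentric coordinates. Only the vertices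
  of the one simplex are asked to have hat functions, since boundary nodes are given none
  later.\<close>

lemma hat_functions_sum_one:
  assumes "conforming_mesh \<T> N" "finite N" "T \<in> \<T>" "x \<in> T"
    and "\<And>y. y \<in> N \<inter> T \<Longrightarrow> hat_function \<T> N y (\<phi> y)"
  shows "(\<Sum>y\<in>N \<inter> T. \<phi> y x) = 1"
proof -
  obtain u where u: "\<forall>v\<in>N \<inter> T. 0 \<le> u v" "sum u (N \<inter> T) = 1" "(\<Sum>v\<in>N \<inter> T. u v *\<^sub>R v) = x"
    using mesh_coordinates[OF assms(1-4)] .
  have "\<phi> y x = u y" if "y \<in> N \<inter> T" for y
    using hat_function_coordinate[OF assms(5)[OF that] assms(2,3) _ u(2,3) assms(4)] that by simp
  then show ?thesis using u(2) by simp
qed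

lemma dist_in_star_le:
  assumes "conforming_mesh \<T> N" "node_size \<T> z \<le> h" "T \<in> \<T>" "z \<in> T" "x \<in> T" "y \<in> T"
  shows "dist x y \<le> h"
proof -
  have fin: "finite \<T>" using assms(1) by (auto simp: conforming_mesh_def triangulation_def)
  have "compact T" using assms(1,3) compact_simplex by (auto simp: conforming_mesh_def)
  then have "dist x y \<le> diameter T"
    using diameter_bounded_bound[OF compact_imp_bounded assms(5,6)] by simp
  also have "\<dots> \<le> node_size \<T> z"
    unfolding node_size_def using fin assms(3,4) by (intro Max_ge) auto
  finally show ?thesis using assms(2) by simp
qed

text \<open>The coordinate \<open>u z\<close> is positive, and the remaining weight
  \<open>1 - u z\<close> sits on vertices within \<open>h\<close> of \<open>z\<close>; this makes
  the distance bound strict.\<close>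

lemma hat_function_support:
  assumes "conforming_mesh \<T> N" "finite N" "hat_function \<T> N z \<phi>" "z \<in> N"
    and size: "node_size \<T> z \<le> h" and h: "0 < h" and x: "\<phi> x \<noteq> 0"
  obtains T where "T \<in> \<T>" "z \<in> T" "x \<in> T" "dist x z < h"
proof -
  have "x \<in> \<Union>\<T>" using assms(3) x unfolding hat_function_def by blast
  then obtain T where T: "T \<in> \<T>" "x \<in> T" by blast
  have zT: "z \<in> T" using hat_function_off_star[OF assms(1-4) T] x by blast
  obtain u where u: "\<forall>v\<in>N \<inter> T. 0 \<le> u v" "sum u (N \<inter> T) = 1" "(\<Sum>v\<in>N \<inter> T. u v *\<^sub>R v) = x"
    using mesh_coordinates[OF assms(1,2) T] .
  have "u z \<noteq> 0" using hat_function_coordinate[OF assms(3,2) T(1) assms(4) u(2,3) T(2)] zT x by simp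
  then have uz: "0 < u z" using u(1) zT assms(4) by force
  have "x - z = (\<Sum>v\<in>N \<inter> T. u v *\<^sub>R (v - z))"
    using u by (simp add: scaleR_right_diff_distrib sum_subtractf flip: scaleR_left.sum)
  also have "\<dots> = (\<Sum>v\<in>N \<inter> T - {z}. u v *\<^sub>R (v - z))"
    using assms(2) by (intro sum.mono_neutral_right) auto
  also have "norm \<dots> \<le> (\<Sum>v\<in>N \<inter> T - {z}. u v * h)"
  proof (rule sum_norm_le)
    fix v assume v: "v \<in> N \<inter> T - {z}"
    have "norm (v - z) \<le> h"
      using dist_in_star_le[OF assms(1) size T(1) zT, of v z] v zT by (simp add: dist_norm)
    then show "norm (u v *\<^sub>R (v - z)) \<le> u v * h" using u(1) v by (simp add: mult_left_mono)
  qed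
  also have "\<dots> = (1 - u z) * h"
    using u(2) assms(2,4) zT by (simp add: sum.remove[of "N \<inter> T" z] flip: sum_distrib_right)
  also have "\<dots> < h" using uz h by simp
  finally show ?thesis using that T zT by (simp add: dist_norm)
qed

text \<open>Continuity is given only on the mesh. The extension by zero glues, because the open ball
  inside the mesh and the complement of \<open>cball z h\<close>, where \<open>\<phi>\<close>
  vanishes, cover the space.\<close>

lemma hat_function_continuous:
  assumes "conforming_mesh \<T> N" "finite N" "hat_function \<T> N z \<phi>" "z \<in> N"
    and size: "node_size \<T> z \<le> h" and h: "0 < h" and r: "h < r" "ball z r \<subseteq> \<Union>\<T>"
  shows "continuous_on UNIV \<phi>"
proof -
  have "continuous_on (ball z r) \<phi>"
    using assms(3) r(2) continuous_on_subset by (auto simp: hat_function_def)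
  moreover have "continuous_on (- cball z h) \<phi>"
  proof -
    have "\<phi> x = 0" if "x \<in> - cball z h" for x
    proof (rule ccontr)
      assume "\<phi> x \<noteq> 0"
      then have "dist x z < h" using hat_function_support[OF assms(1-4) size h] by metis
      with that show False by (simp add: dist_commute)
    qed
    then show ?thesis using continuous_on_cong[OF refl, of "- cball z h" \<phi> "\<lambda>_. 0"] by simp
  qed
  ultimately have "continuous_on (ball z r \<union> - cball z h) \<phi>"
    by (intro continuous_on_open_Un) (auto intro: open_Compl)
  moreover have "ball z r \<union> - cball z h = UNIV" using r(1) by auto
  ultimately show ?thesis by simp
qed

text \<open>The union of the translates of \<open>W\<close> is open, and equal to that of \<open>K\<close>, hence closed.\<close>

lemma (in lattice_basis) lattice_translates_cover_if_local:
  assumes W: "open W" "w \<in> W" and K: "compact K" "W \<subseteq> K"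
    and cover: "\<And>a. a \<in> K \<Longrightarrow> \<exists>k. a - lat k \<in> W"
  shows "\<exists>k. x - lat k \<in> W"
proof -
  define U where "U = (\<Union>k. (+) (lat k) ` W)"
  have "open U" unfolding U_def using W(1) by (intro open_UN ballI open_translation)
  moreover have "U = (\<Union>a\<in>K. \<Union>b\<in>range lat. {a + b})"
  proof safe
    fix x assume "x \<in> U"
    then obtain k w where "w \<in> W" "x = lat k + w" unfolding U_def by blast
    then have "w \<in> W" "x = w + lat k" by simp_all
    then show "x \<in> (\<Union>a\<in>K. \<Union>b\<in>range lat. {a + b})" using K(2) by blast
  next
    fix a m assume "a \<in> K"
    then obtain k where "a - lat k \<in> W" using cover by blast
    moreover have "a + lat m = lat (\<lambda>j. m j + k j) + (a - lat k)" by (simp add: lat_add)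
    ultimately show "a + lat m \<in> U" unfolding U_def by blast
  qed
  then have "closed U" using compact_closed_sums[OF K(1) closed_lat] by simp
  ultimately have "U = UNIV" using clopen[of U] W(2) by (auto simp: U_def)
  then obtain k w where "w \<in> W" "x = lat k + w" unfolding U_def by blast
  then show ?thesis by (intro exI[of _ k]) simp
qed

text \<open>Periodicity is known only near \<open>z\<close>. The translates of the set where the hat
  is positive nevertheless cover the space, so every \<open>x\<close> can be moved into the star of
  \<open>z\<close>, where the nodal partition of unity consists of translates of
  \<open>\<phi> z\<close>.\<close>

lemma hat_translates_sum_one:
  fixes \<Omega> N0 Nb :: "(real ^ 'n) set"
  assumes "lattice_basis e h"
    and mesh: "conforming_mesh \<T> (N0 \<union> Nb)" and fin: "finite (N0 \<union> Nb)"
    and \<Omega>: "open \<Omega>" "Nb \<subseteq> frontier \<Omega>" and N0: "N0 = range (lattice_basis.lat e h) \<inter> \<Omega>"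
    and hat: "\<And>y. y \<in> N0 \<Longrightarrow> hat_function \<T> (N0 \<union> Nb) y (\<phi> y)"
    and size: "\<And>y. y \<in> N0 \<Longrightarrow> node_size \<T> y \<le> h"
    and tib: "translation_invariant_basis \<T> N0 h \<phi>"
    and z: "z \<in> N0" and far: "3 * h \<le> infdist z (frontier (\<Union>\<T>))"
    and inside: "ball z (3 * h) \<subseteq> \<Union>\<T>" "ball z (3 * h) \<subseteq> \<Omega>"
  shows "(\<integral>\<^sup>+k. ennreal (\<phi> z (z + (x - lattice_basis.lat e h k))) \<partial>count_space UNIV) = 1"
proof -
  interpret lattice_basis e h by fact
  define N where "N = N0 \<union> Nb"
  define \<psi> where "\<psi> w = \<phi> z (z + w)" for w
  have zN: "z \<in> N" using z by (simp add: N_def)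
  note mesh' = mesh[folded N_def] and fin' = fin[folded N_def] and hat' = hat[folded N_def]
  have nonneg: "0 \<le> \<phi> y x" if "y \<in> N0" for x y
    using hat_function_nonneg[OF mesh' fin' hat'[OF that]] that by (simp add: N_def)
  have supp: "\<exists>T\<in>\<T>. z \<in> T \<and> z + w \<in> T \<and> norm w < h" if "\<psi> w \<noteq> 0" for w
    using hat_function_support[OF mesh' fin' hat'[OF z] zN size[OF z] h, of "z + w"] that
    by (auto simp: \<psi>_def dist_norm)
  \<comment> \<open>A shift below \<open>2 * h\<close> keeps the node inside the domain and, as
    \<open>z\<close> is \<open>3 * h\<close> deep, farther than \<open>h\<close> from the mesh
    boundary, as translation invariance demands.\<close>
  have deep: "z + lat m \<in> N0 \<and> (\<forall>x. \<phi> (z + lat m) x = \<psi> (x - (z + lat m)))"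
    if "norm (lat m) < 2 * h" for m
  proof -
    obtain k where k: "z = lat k" using z N0 by auto
    have "z + lat m \<in> ball z (3 * h)" using that h by (simp add: dist_norm)
    then have "z + lat m \<in> N0" using inside(2) N0 k lat_add[of k m] by (auto simp: image_iff) (metis)
    moreover have "h < infdist (z + lat m) (frontier (\<Union>\<T>))"
      using infdist_triangle[of z "frontier (\<Union>\<T>)" "z + lat m"] far that by (simp add: dist_norm)
    moreover have "h < infdist z (frontier (\<Union>\<T>))" using far h by linarith
    ultimately have "z + lat m \<in> N0 \<and> (\<forall>x. \<phi> (z + lat m) (x + (z + lat m)) = \<phi> z (x + z))"
      using tib z unfolding translation_invariant_basis_def by blast
    moreover have "x - (z + lat m) + (z + lat m) = x" for x by simp
    ultimately show ?thesis unfolding \<psi>_def by (metis add.commute)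
  qed
  \<comment> \<open>Vertices of the star of \<open>z\<close> lie in the open domain, hence are
    interior nodes and lattice points.\<close>
  have vert: "c \<in> N0 \<and> (\<exists>m. c = z + lat m \<and> norm (lat m) < 2 * h)"
    if T: "T \<in> \<T>" "z \<in> T" and c: "c \<in> N \<inter> T" for c T
  proof -
    have "dist c z \<le> h" using dist_in_star_le[OF mesh' size[OF z] T, of c z] c T by simp
    then have "c \<in> ball z (3 * h)" using h by (simp add: dist_commute)
    then have "c \<in> \<Omega>" using inside(2) by blast
    then have cN0: "c \<in> N0" using c \<Omega> by (auto simp: N_def frontier_def interior_open)
    then obtain k k' where k: "c = lat k" "z = lat k'" using z N0 by auto
    then have "c = z + lat (\<lambda>j. k j - k' j)" by (simp add: lat_diff)
    moreover have "norm (c - z) < 2 * h" using \<open>dist c z \<le> h\<close> h by (simp add: dist_norm)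
    ultimately show ?thesis using cN0 by (metis add_diff_cancel_left')
  qed
  have sum1: "(\<Sum>c\<in>N \<inter> T. \<phi> c x) = 1" if "T \<in> \<T>" "z \<in> T" "x \<in> T" for T x
    using hat_functions_sum_one[OF mesh' fin' that(1,3)] hat' vert[OF that(1,2)] by blast
  define K where "K = (\<lambda>x. x - z) ` \<Union>{T\<in>\<T>. z \<in> T}"
  have K: "compact K"
    unfolding K_def using mesh
    by (intro compact_translation_subtract compact_Union)
      (auto simp: conforming_mesh_def triangulation_def intro: compact_simplex)
  have "continuous_on UNIV (\<phi> z)"
    using hat_function_continuous[OF mesh' fin' hat'[OF z] zN size[OF z] h _ inside(1)] h by simp
  then have "continuous_on UNIV \<psi>"
    unfolding \<psi>_def by (rule continuous_on_compose2) (auto intro: continuous_intros)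
  then have "open {w. 0 < \<psi> w}" by (intro open_Collect_less continuous_intros)
  moreover have "0 \<in> {w. 0 < \<psi> w}"
    using hat[OF z] by (simp add: \<psi>_def hat_function_def)
  moreover have "{w. 0 < \<psi> w} \<subseteq> K"
  proof
    fix w assume "w \<in> {w. 0 < \<psi> w}"
    then obtain T where "T \<in> \<T>" "z \<in> T" "z + w \<in> T" using supp[of w] by auto
    then show "w \<in> K" unfolding K_def by (intro image_eqI[of _ _ "z + w"]) auto
  qed
  \<comment> \<open>The hats at the vertices of \<open>T\<close> sum to one at \<open>x\<close>, so
    one is positive there, and it is a translate of \<open>\<psi>\<close>.\<close>
  moreover have "\<exists>k. a - lat k \<in> {w. 0 < \<psi> w}" if a: "a \<in> K" for a
  proof -
    obtain T x where T: "T \<in> \<T>" "z \<in> T" "x \<in> T" "a = x - z" using a by (auto simp: K_def)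
    have "\<exists>c\<in>N \<inter> T. 0 < \<phi> c x"
    proof (rule ccontr)
      assume "\<not> (\<exists>c\<in>N \<inter> T. 0 < \<phi> c x)"
      then have "(\<Sum>c\<in>N \<inter> T. \<phi> c x) \<le> 0" by (intro sum_nonpos) (auto simp: not_less)
      then show False using sum1[OF T(1-3)] by simp
    qed
    then obtain c where c: "c \<in> N \<inter> T" "0 < \<phi> c x" by blast
    then obtain m where m: "c = z + lat m" "norm (lat m) < 2 * h" using vert[OF T(1,2)] by blast
    then have "0 < \<psi> (x - (z + lat m))" using deep[OF m(2)] c(2) by simp
    then show ?thesis using T(4) by (auto simp: algebra_simps)
  qed
  ultimately have "\<exists>k. x - lat k \<in> {w. 0 < \<psi> w}"
    by (rule lattice_translates_cover_if_local[OF _ _ K])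
  then obtain k0 where k0: "0 < \<psi> (x - lat k0)" by blast
  define x' where "x' = z + (x - lat k0)"
  obtain T where T: "T \<in> \<T>" "z \<in> T" "x' \<in> T" and near: "norm (x - lat k0) < h"
    using supp[of "x - lat k0"] k0 unfolding x'_def by auto
  \<comment> \<open>Chosen so that the hat at \<open>node k\<close>, evaluated at \<open>x'\<close>,
    equals \<open>\<psi> (x - lat k)\<close> whenever \<open>node k\<close> is near
    \<open>z\<close>.\<close>
  define node where "node k = z + lat k - lat k0" for k
  have node: "node k = z + lat (\<lambda>j. k j - k0 j)" for k by (simp add: node_def lat_diff)
  define I where "I = {k. node k \<in> N \<inter> T}"
  have inj: "inj node" using inj_lat by (auto simp: node_def inj_def)
  have img: "node ` I = N \<inter> T"
  proof
    show "N \<inter> T \<subseteq> node ` I"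
    proof
      fix c assume c: "c \<in> N \<inter> T"
      then obtain m where "c = z + lat m" using vert[OF T(1,2)] by blast
      then have "c = node (\<lambda>j. m j + k0 j)" by (simp add: node_def lat_add)
      with c show "c \<in> node ` I" by (auto simp: I_def)
    qed
  qed (auto simp: I_def)
  have finI: "finite I" using img fin' inj by (metis finite_Int finite_imageD inj_on_subset subset_UNIV)
  have eq: "\<phi> (node k) x' = \<psi> (x - lat k)" if "norm (node k - z) < 2 * h" for k
    using deep[of "\<lambda>j. k j - k0 j"] that by (simp add: node x'_def lat_diff algebra_simps)
  \<comment> \<open>A nonzero value makes both \<open>x - lat k\<close> and
    \<open>x - lat k0\<close> shorter than \<open>h\<close>, so \<open>node k\<close> is within
    \<open>2 * h\<close> of \<open>z\<close>. Its hat is then nonzero at \<open>x'\<close>, which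
    puts it in \<open>T\<close>.\<close>
  have out: "\<psi> (x - lat k) = 0" if k: "k \<notin> I" for k
  proof (rule ccontr)
    assume nz: "\<psi> (x - lat k) \<noteq> 0"
    then have "norm (x - lat k) < h" using supp by blast
    then have "norm (node k - z) < 2 * h"
      using near norm_triangle_ineq4[of "x - lat k0" "x - lat k"] by (simp add: node_def)
    then have "node k \<in> N0" "\<phi> (node k) x' \<noteq> 0"
      using deep[of "\<lambda>j. k j - k0 j"] eq[of k] nz by (simp_all add: node)
    then have "node k \<in> T"
      using hat_function_off_star[OF mesh' fin' hat' _ T(1,3)] by (auto simp: N_def)
    then show False using k \<open>node k \<in> N0\<close> by (simp add: I_def N_def)
  qed
  have "(\<integral>\<^sup>+k. ennreal (\<psi> (x - lat k)) \<partial>count_space UNIV) = (\<Sum>k\<in>I. ennreal (\<psi> (x - lat k)))"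
    using finI out by (intro nn_integral_count_space') auto
  also have "\<dots> = (\<Sum>k\<in>I. ennreal (\<phi> (node k) x'))"
  proof (intro sum.cong refl)
    fix k assume "k \<in> I"
    then have "\<exists>m. node k = z + lat m \<and> norm (lat m) < 2 * h"
      using vert[OF T(1,2)] by (simp add: I_def)
    then have "norm (node k - z) < 2 * h" by auto
    then show "ennreal (\<psi> (x - lat k)) = ennreal (\<phi> (node k) x')" using eq by simp
  qed
  also have "\<dots> = (\<Sum>c\<in>N \<inter> T. ennreal (\<phi> c x'))"
    using sum.reindex[of node I "\<lambda>c. ennreal (\<phi> c x')"] inj inj_on_subset img by fastforce
  also have "\<dots> = ennreal (\<Sum>c\<in>N \<inter> T. \<phi> c x')"
    using nonneg vert[OF T(1,2)] by (intro sum_ennreal) auto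
  also have "\<dots> = 1" using sum1[OF T] by simp
  finally show ?thesis by (simp add: \<psi>_def)
qed

section \<open>Linear images and quadratic polynomials\<close>

lemma measure_shear_cbox:
  fixes a b :: "real ^ 'n"
  assumes "m \<noteq> n"
  defines "f \<equiv> \<lambda>x :: real ^ 'n. \<chi> i. if i = m then x $ m + x $ n else x $ i"
  shows "measure lebesgue (f ` cbox a b) = measure lebesgue (cbox a b)"
proof (cases "cbox a b = {}")
  case False
  \<comment> \<open>Shifting by \<open>w\<close> moves the lower \<open>n\<close>-th coordinate of
    the box to zero, as suits \<open>measure_shear_interval\<close>.\<close>
  define w where "w = axis n (a $ n)"
  have shift: "cbox (a - w) (b - w) = (+) (- w) ` cbox a b"
    using cbox_translation[of "- w" a b] by simp
  have "f x = f w + f (- w + x)" for x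
    using assms(1) by (auto simp: f_def vec_eq_iff)
  then have "f ` cbox a b = (+) (f w) ` f ` cbox (a - w) (b - w)"
    unfolding shift image_image by (intro image_cong refl)
  then have "measure lebesgue (f ` cbox a b) = measure lebesgue (f ` cbox (a - w) (b - w))"
    by (simp only: measure_translation)
  also have "\<dots> = measure lebesgue (cbox (a - w) (b - w))"
    unfolding f_def using assms(1) False
    by (intro measure_shear_interval) (simp_all only: shift image_is_empty, simp_all add: w_def)
  also have "\<dots> = measure lebesgue (cbox a b)"
    unfolding shift by (rule measure_translation)
  finally show ?thesis .
qed simp

lemma measure_swap_cbox:
  fixes a b :: "real ^ 'n"
    and m n :: 'n
  defines "f \<equiv> \<lambda>x :: real ^ 'n. \<chi> i. x $ Transposition.transpose m n i"
  shows "measure lebesgue (f ` cbox a b) = measure lebesgue (cbox a b)"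
proof (cases "cbox a b = {}")
  case False
  have ff: "f (f x) = x" for x by (simp add: f_def vec_eq_iff)
  have mem: "f x \<in> cbox (f a) (f b) \<longleftrightarrow> x \<in> cbox a b" for x
    unfolding mem_box_cart f_def by (simp, metis transpose_involutory)
  have "f ` cbox a b = cbox (f a) (f b)"
  proof
    show "cbox (f a) (f b) \<subseteq> f ` cbox a b"
    proof
      fix y assume "y \<in> cbox (f a) (f b)"
      then have "f y \<in> cbox a b" using mem[of "f y"] ff by simp
      then show "y \<in> f ` cbox a b" using ff[of y] by (metis imageI)
    qed
  qed (use mem in auto)
  moreover have "cbox (f a) (f b) \<noteq> {}" using False mem by blast
  moreover have "(\<Prod>i\<in>UNIV. f b $ i - f a $ i) = (\<Prod>i\<in>UNIV. b $ i - a $ i)"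
    unfolding f_def using prod.permute[OF permutes_swap_id[of m UNIV n], of "\<lambda>i. b $ i - a $ i"]
    by (simp add: o_def)
  ultimately show ?thesis using False by (simp add: content_cbox_cart)
qed simp

text \<open>The library's \<open>measure_linear_image\<close> demands a wellordered index type.\<close>

lemma measure_matrix_image:
  fixes A :: "real ^ 'n ^ 'n"
  assumes "S \<in> lmeasurable"
  shows "measure lebesgue ((\<lambda>x. A *v x) ` S) = \<bar>det A\<bar> * measure lebesgue S"
proof -
  \<comment> \<open>If the determinant has absolute value one, preserving the volume of boxes
    suffices; this settles swaps and shears.\<close>
  have boxes: "\<forall>S\<in>lmeasurable. (\<lambda>x. A *v x) ` S \<in> lmeasurable
      \<and> measure lebesgue ((\<lambda>x. A *v x) ` S) = \<bar>det A\<bar> * measure lebesgue S"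
    if "\<bar>det A\<bar> = 1" "\<And>a b. measure lebesgue ((\<lambda>x. A *v x) ` cbox a b) = measure lebesgue (cbox a b)"
    for A :: "real ^ 'n ^ 'n"
  proof
    fix S :: "(real ^ 'n) set" assume S: "S \<in> lmeasurable"
    show "(\<lambda>x. A *v x) ` S \<in> lmeasurable
        \<and> measure lebesgue ((\<lambda>x. A *v x) ` S) = \<bar>det A\<bar> * measure lebesgue S"
      using measure_linear_sufficient[OF matrix_vector_mul_linear[of A] S, of 1] that by simp
  qed
  \<comment> \<open>Measurability of the image belongs to the claim because the product case applies
    the claim for one factor to an image under the other.\<close>
  have "\<forall>S\<in>lmeasurable. (\<lambda>x. A *v x) ` S \<in> lmeasurable
      \<and> measure lebesgue ((\<lambda>x. A *v x) ` S) = \<bar>det A\<bar> * measure lebesgue S"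
  proof (induction A rule: induct_matrix_elementary_alt)
    case (1 A B)
    have "(\<lambda>x. (A ** B) *v x) ` S = (\<lambda>x. A *v x) ` (\<lambda>x. B *v x) ` S" for S
      by (simp add: image_image matrix_vector_mul_assoc)
    then show ?case using 1 by (simp add: det_mul abs_mult)
  next
    case (2 A i)
    have "negligible ((\<lambda>x. A *v x) ` S)" for S
      using 2 by (intro negligible_subset[OF negligible_standard_hyperplane_cart[of i]])
        (auto simp: matrix_vector_mul_component row_def vec_eq_iff inner_vec_def)
    moreover have "det A = 0" using 2 by (intro det_zero_row) auto
    ultimately show ?case by (simp add: negligible_iff_measure)
  next
    case (3 A)
    have "(\<Sum>j\<in>UNIV. A $ k $ j * x $ j) = A $ k $ k * x $ k" for x k
      using 3 by (subst sum.remove[of _ k]) (auto intro!: sum.neutral)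
    then have "(\<lambda>x. A *v x) = (\<lambda>x. \<chi> k. A $ k $ k * x $ k)"
      by (simp add: fun_eq_iff matrix_vector_mult_def vec_eq_iff)
    then show ?case using 3 by (simp add: measurable_stretch measure_stretch det_diagonal)
  next
    case (4 m n)
    define P :: "real ^ 'n ^ 'n" where "P = (\<chi> i j. mat 1 $ i $ Transposition.transpose m n j)"
    have "(i = Transposition.transpose m n j) = (Transposition.transpose m n i = j)" for i j
      by (metis transpose_involutory)
    then have "P *v x = (\<chi> i. x $ Transposition.transpose m n i)" for x
      by (simp add: P_def matrix_vector_mult_def vec_eq_iff mat_def if_distrib[of "\<lambda>u. u * _"] cong: if_cong)
    moreover have "\<bar>det P\<bar> = 1"
      unfolding P_def using 4
      by (subst det_permute_columns) (simp_all add: permutes_swap_id sign_swap_id)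
    ultimately show ?case
      unfolding P_def[symmetric] using measure_swap_cbox[of m n] by (intro boxes) simp_all
  next
    case (5 m n)
    define E :: "real ^ 'n ^ 'n" where "E = (\<chi> i j. of_bool (i = m \<and> j = n \<or> i = j))"
    have "E = (\<chi> k. if k = m then row m (mat 1) + 1 *s row n (mat 1) else row k (mat 1))"
      using 5 by (auto simp: E_def vec_eq_iff row_def mat_def)
    then have "det E = 1" using det_row_operation[OF 5, of "mat 1 :: real ^ 'n ^ 'n" 1] by simp
    moreover have "E *v x = (\<chi> i. if i = m then x $ m + x $ n else x $ i)" for x
    proof -
      have "E $ i $ j * x $ j = (if j = i then x $ i else 0) + (if j = n then if i = m then x $ n else 0 else 0)" for i j
        using 5 by (auto simp: E_def)
      then show ?thesis by (simp add: matrix_vector_mult_def vec_eq_iff sum.distrib)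
    qed
    ultimately show ?case
      unfolding E_def[symmetric] using measure_shear_cbox[OF 5] by (intro boxes) simp_all
  qed
  then show ?thesis using assms by blast
qed

section \<open>Hessian and expansion of quadratic polynomials\<close>

lemma inner_transpose_mult:
  fixes B :: "real ^ 'n ^ 'n"
  shows "u \<bullet> (transpose B *v v) = v \<bullet> (B *v u)"
  by (metis dot_lmul_matrix inner_commute transpose_matrix_vector)

lemma partial_deriv_quadratic:
  fixes B :: "real ^ 'n ^ 'n"
  assumes p: "\<And>x. p x = x \<bullet> (B *v x) + b \<bullet> x + c"
  shows "partial_deriv k p x = ((B + transpose B) *v x + b) $ k"
proof -
  have "x \<bullet> (B *v axis k 1) = (transpose B *v x) $ k"
    using inner_transpose_mult[of "axis k 1" B x] by (simp add: inner_axis' del: transpose_matrix_vector)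
  then have "p (x + t *\<^sub>R axis k 1) = p x + t * ((B + transpose B) *v x + b) $ k
      + t\<^sup>2 * (axis k 1 \<bullet> (B *v axis k 1))" for t
    by (simp add: p matrix_vector_right_distrib matrix_vector_mult_scaleR inner_add_left inner_add_right
      matrix_vector_mult_add_rdistrib inner_axis' inner_axis power2_eq_square algebra_simps)
  then have "((\<lambda>t. p (x + t *\<^sub>R axis k 1)) has_field_derivative ((B + transpose B) *v x + b) $ k) (at 0)"
    by (auto intro!: derivative_eq_intros)
  then show ?thesis unfolding partial_deriv_def by (rule DERIV_imp_deriv)
qed

text \<open>The matrix \<open>B\<close> need not be symmetric and \<open>p\<close> carries no factor
  1/2, hence the sum with the transpose.\<close>

lemma hessian_quadratic:
  fixes B :: "real ^ 'n ^ 'n"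
  assumes p: "\<And>x. p x = x \<bullet> (B *v x) + b \<bullet> x + c"
  shows "hessian p x = B + transpose B"
proof -
  let ?A = "B + transpose B"
  have "partial_deriv k (partial_deriv m p) x = ?A $ m $ k" for k m
  proof -
    have "partial_deriv m p (x + t *\<^sub>R axis k 1) = (?A *v x + b) $ m + t * ?A $ m $ k" for t
      by (simp add: partial_deriv_quadratic[OF p] matrix_vector_right_distrib matrix_vector_mult_scaleR
        matrix_vector_mul_component inner_axis)
    then have "((\<lambda>t. partial_deriv m p (x + t *\<^sub>R axis k 1)) has_field_derivative ?A $ m $ k) (at 0)"
      by (auto intro!: derivative_eq_intros)
    then show ?thesis unfolding partial_deriv_def[of k] by (rule DERIV_imp_deriv)
  qed
  then show ?thesis by (simp add: hessian_def vec_eq_iff transpose_def)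
qed

text \<open>Taylor expansion at \<open>z\<close> is exact for a quadratic; it turns a subgradient
  inequality into one between a linear term and the Hessian form.\<close>

lemma quadratic_expansion:
  fixes B :: "real ^ 'n ^ 'n"
  assumes p: "\<And>x. p x = x \<bullet> (B *v x) + b \<bullet> x + c"
  shows "p y = p z + ((B + transpose B) *v z + b) \<bullet> (y - z)
    + (y - z) \<bullet> ((B + transpose B) *v (y - z)) / 2"
proof -
  define w where "w = y - z"
  have y: "y = z + w" by (simp add: w_def)
  show ?thesis unfolding y
    using inner_transpose_mult[of w B w] inner_transpose_mult[of w B z]
    by (simp add: p matrix_vector_right_distrib matrix_vector_mult_add_rdistrib inner_add_left inner_add_right
       inner_commute[of _ w] algebra_simps)
qed

text \<open>A ball is connected, so one leaving \<open>S\<close> would meet the frontier at a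
  distance below \<open>r\<close> from \<open>z\<close>.\<close>

lemma ball_subset_if_infdist_frontier:
  fixes S :: "'a::euclidean_space set"
  assumes "z \<in> S" "r \<le> infdist z (frontier S)"
  shows "ball z r \<subseteq> S"
proof (rule ccontr)
  assume "\<not> ball z r \<subseteq> S"
  then have ne: "ball z r - S \<noteq> {}" by blast
  then have "0 < r" by (metis Diff_eq_empty_iff ball_empty empty_subsetI not_le)
  then have "z \<in> ball z r \<inter> S" using assms(1) by simp
  then obtain w where "w \<in> ball z r" "w \<in> frontier S"
    using connected_Int_frontier[of "ball z r" S] ne by blast
  then show False using infdist_le[of w "frontier S" z] assms(2) by simp
qed

theorem lemma5p3:
  fixes \<Omega> N0 Nb :: "(real ^ 'n) set"
    and \<T> :: "(real ^ 'n) set set"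
    and \<phi> :: "real ^ 'n \<Rightarrow> real ^ 'n \<Rightarrow> real"
    and p p\<^sub>h :: "real ^ 'n \<Rightarrow> real"
    and h \<gamma> \<sigma> l L :: real
  assumes "CARD('n) \<ge> 2"
    and "uniformly_convex_domain \<Omega>"
    and "finite (N0 \<union> Nb)" and "N0 \<subseteq> \<Omega>" and "Nb \<subseteq> frontier \<Omega>"
    and "conforming_mesh \<T> (N0 \<union> Nb)" and "\<Union>\<T> \<subseteq> closure \<Omega>"
    and "0 < h" and "0 < \<gamma>" and "\<gamma> \<le> 1" and "quasi_uniform \<T> N0 \<gamma> h"
    and "shape_regular \<T> \<sigma>"
    and "translation_invariant_nodes \<Omega> N0 Nb h"
    and "\<forall>z\<in>N0. hat_function \<T> (N0 \<union> Nb) z (\<phi> z)"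
    and "translation_invariant_basis \<T> N0 h \<phi>"
    and "quadratic_polynomial p" and "convex_on UNIV p"
    and "0 < l" and "l \<le> L"
    and "\<forall>x. loewner_le (mat l) (hessian p x) \<and> loewner_le (hessian p x) (mat L)"
    and "\<forall>z\<in>N0 \<union> Nb. p\<^sub>h z = p z"
  shows "\<forall>z\<in>N0. infdist z (frontier (\<Union>\<T>)) \<ge> L / l * \<sigma>\<^sup>2 * h \<longrightarrow>
           measure lebesgue (nodal_subdifferential (N0 \<union> Nb) p\<^sub>h z) =
           (LINT x:\<Omega>|lebesgue. \<phi> z x * det (hessian p x))"
proof (intro ballI impI)
  fix z assume z: "z \<in> N0" and far: "L / l * \<sigma>\<^sup>2 * h \<le> infdist z (frontier (\<Union>\<T>))"
  define N where "N = N0 \<union> Nb"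
  define d where "d = real CARD('n)"
  define R where "R = L / l * \<sigma>\<^sup>2"
  obtain e :: "'n \<Rightarrow> real ^ 'n" where e: "inj e" "independent (range e)" "span (range e) = UNIV"
      "\<forall>j. norm (e j) \<le> 1"
    and N0: "N0 = {h *\<^sub>R (\<Sum>j\<in>UNIV. of_int (k j) *\<^sub>R e j) | k :: 'n \<Rightarrow> int. True} \<inter> \<Omega>"
    using assms(13) unfolding translation_invariant_nodes_def by blast
  obtain B b c where p: "\<And>x. p x = x \<bullet> (B *v x) + b \<bullet> x + c"
    using assms(16) unfolding quadratic_polynomial_def by blast
  define A where "A = B + transpose B"
  have hess: "hessian p x = A" for x unfolding A_def by (rule hessian_quadratic[OF p])
  interpret lattice_metric e h A l L
  proof
    show "(A *v u) \<bullet> v = u \<bullet> (A *v v)" for u v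
      using inner_transpose_mult[of v B u] inner_transpose_mult[of u B v]
      by (simp add: A_def matrix_vector_mult_add_rdistrib inner_add_right inner_add_left
        inner_commute[of _ v] del: transpose_matrix_vector)
    have mat: "v \<bullet> (mat a *v v) = a * (norm v)\<^sup>2" for a :: real and v :: "real ^ 'n"
    proof -
      have "mat a = a *\<^sub>R (mat 1 :: real ^ 'n ^ 'n)" by (simp add: mat_def vec_eq_iff)
      then show ?thesis by (simp add: power2_norm_eq_inner flip: scaleR_matrix_vector_assoc)
    qed
    show "l * (norm v)\<^sup>2 \<le> v \<bullet> (A *v v)" for v
      using assms(20) by (simp add: loewner_le_def hess mat)
    show "v \<bullet> (A *v v) \<le> L * (norm v)\<^sup>2" for v
      using assms(20) by (simp add: loewner_le_def hess mat)
  qed (use e assms(8,18) in simp_all)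
  have N0_lat: "N0 = range lat \<inter> \<Omega>" unfolding N0 lat_def by auto
  have \<Omega>: "open \<Omega>" "convex \<Omega>" using assms(2) by (auto simp: uniformly_convex_domain_def)
  have "z \<in> {x. \<exists>T\<in>\<T>. x extreme_point_of T}"
    using assms(6) z unfolding conforming_mesh_def by blast
  then obtain T0 where T0: "T0 \<in> \<T>" "z \<in> T0" by (auto simp: extreme_point_of_def)
  then have simplex: "int DIM(real ^ 'n) simplex T0"
    using assms(6) unfolding conforming_mesh_def by blast
  have d: "2 \<le> d" using assms(1) by (simp add: d_def)
  \<comment> \<open>Since \<open>d \<ge> 2\<close>, this is at least \<open>3 * d / 2\<close>, from
    which both lower bounds on \<open>R\<close> follow.\<close>
  have "d * (d + 1) / 2 \<le> \<sigma>\<^sup>2"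
    using shape_regular_lower_bound[OF assms(12) T0(1) simplex] by (simp add: d_def algebra_simps)
  then have "L / l * (d * (d + 1) / 2) \<le> R"
    unfolding R_def using assms(18,19) by (intro mult_left_mono) auto
  moreover have "L / l * (d * (3 / 2)) \<le> L / l * (d * (d + 1) / 2)"
    using d assms(18,19) by (intro mult_left_mono) auto
  ultimately have R: "L / l * (d * (3 / 2)) \<le> R" by linarith
  have "1 * (2 * (3 / 2)) \<le> L / l * (d * (3 / 2))"
    using d assms(18,19) by (intro mult_mono) auto
  then have R3: "3 \<le> R" using R by linarith
  \<comment> \<open>The factor 9/4, the square of 3/2, supplies the strictness required by
    \<open>voronoi_local\<close>.\<close>
  have Rd: "L * d\<^sup>2 < l * R\<^sup>2"
  proof -
    have "1 \<le> L / l" using assms(18,19) by simp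
    define X where "X = L * (9 / 4 * d\<^sup>2)"
    have "0 < L * d\<^sup>2" using d assms(18,19) by simp
    then have X: "L * d\<^sup>2 < X" unfolding X_def by simp
    also have "X = 1 * X" by simp
    also have "1 * X \<le> (L / l) * X"
      using \<open>1 \<le> L / l\<close> \<open>0 < L * d\<^sup>2\<close> X by (intro mult_right_mono) linarith+
    also have "\<dots> = l * (L / l * (d * (3 / 2)))\<^sup>2"
      using assms(18) by (simp add: X_def power2_eq_square field_simps)
    also have "\<dots> \<le> l * R\<^sup>2" using R d assms(18,19) by (intro mult_left_mono power_mono) auto
    finally show ?thesis .
  qed
  have far3: "3 * h \<le> infdist z (frontier (\<Union>\<T>))"
    using far mult_right_mono[OF R3, of h] assms(8) by (simp add: R_def)
  have ballT: "ball z (R * h) \<subseteq> \<Union>\<T>"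
    using ball_subset_if_infdist_frontier[of z "\<Union>\<T>" "R * h"] T0 far by (auto simp: R_def)
  \<comment> \<open>The mesh lies only in the closure of the domain; convexity lets an open ball in
    the closure fall inside the domain.\<close>
  have "interior (closure \<Omega>) = \<Omega>" using \<Omega> by (simp add: convex_interior_closure interior_open)
  then have ball\<Omega>: "ball z (R * h) \<subseteq> \<Omega>"
    using interior_maximal[of "ball z (R * h)" "closure \<Omega>"] ballT assms(7) by auto
  have ball3: "ball z (3 * h) \<subseteq> ball z (R * h)" using R3 assms(8) by (intro subset_ball) simp

  \<comment> \<open>\<open>A *v z + b\<close> is the gradient of \<open>p\<close> at
    \<open>z\<close>. For the slope \<open>A *v z + b + A *v u\<close>, the exact expansion turns
    the subgradient inequality at \<open>y\<close> into
    \<open>2 * (u \<bullet> (A *v (y - z))) \<le> q (y - z)\<close>.\<close>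
  have subdiff: "nodal_subdifferential N p\<^sub>h z = (+) (A *v z + b) ` ((\<lambda>u. A *v u) ` voronoi)"
  proof -
    obtain kz where zlat: "z = lat kz" using z N0_lat by blast
    \<comment> \<open>All lattice points within \<open>R * h\<close> of \<open>z\<close> are nodes,
      which is enough to force \<open>u\<close> into the cell; conversely the remaining nodes impose
      nothing new.\<close>
    have cell: "(\<forall>y\<in>N. 2 * (u \<bullet> (A *v (y - z))) \<le> q (y - z)) \<longleftrightarrow> u \<in> voronoi" for u
    proof
      assume u: "\<forall>y\<in>N. 2 * (u \<bullet> (A *v (y - z))) \<le> q (y - z)"
      show "u \<in> voronoi"
      proof (rule voronoi_local[of R])
        fix k assume k: "norm (lat k) < R * h"
        then have "z + lat k \<in> \<Omega>" using subsetD[OF ball\<Omega>, of "z + lat k"] by (simp add: dist_norm)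
        moreover have "z + lat k \<in> range lat" unfolding zlat lat_add[symmetric] by (rule rangeI)
        ultimately have "z + lat k \<in> N" by (simp add: N_def N0_lat)
        then show "2 * (u \<bullet> (A *v lat k)) \<le> q (lat k)" using u by fastforce
      qed (use Rd R3 in \<open>auto simp: d_def\<close>)
    next
      assume u: "u \<in> voronoi"
      show "\<forall>y\<in>N. 2 * (u \<bullet> (A *v (y - z))) \<le> q (y - z)"
      proof
        fix y assume y: "y \<in> N"
        show "2 * (u \<bullet> (A *v (y - z))) \<le> q (y - z)"
        \<comment> \<open>A boundary node may happen to be a lattice point, so the split is by
          membership in the lattice; off the lattice a node is a boundary node at distance at least
          \<open>R * h\<close>.\<close>
        proof (cases "y \<in> range lat")
          case True
          then obtain k where "y = lat k" by blast
          then have "y - z = lat (\<lambda>j. k j - kz j)" by (simp add: zlat lat_diff)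
          then show ?thesis using u by (simp add: voronoi_def)
        next
          case False
          then have "y \<in> frontier \<Omega>" using y assms(5) by (auto simp: N_def N0_lat)
          then have "y \<notin> ball z (R * h)" using ball\<Omega> \<Omega>(1) by (auto simp: frontier_def interior_open)
          then have "R * h \<le> norm (y - z)" by (simp add: dist_norm norm_minus_commute)
          then show ?thesis using voronoi_far[OF _ _ u, of R] Rd R3 by (simp add: d_def)
        qed
      qed
    qed
    have sub: "A *v z + b + A *v u \<in> nodal_subdifferential N p\<^sub>h z \<longleftrightarrow> u \<in> voronoi" for u
    proof -
      have "p\<^sub>h z + (A *v z + b + A *v u) \<bullet> (y - z) \<le> p\<^sub>h y \<longleftrightarrow> 2 * (u \<bullet> (A *v (y - z))) \<le> q (y - z)"
        if y: "y \<in> N" for y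
      proof -
        have "p\<^sub>h y = p y" "p\<^sub>h z = p z" using assms(21) y z by (auto simp: N_def)
        moreover have "p y = p z + (A *v z + b) \<bullet> (y - z) + q (y - z) / 2"
          using quadratic_expansion[OF p, of y z] by (simp only: A_def[symmetric] q_def)
        moreover have "(A *v z + b + A *v u) \<bullet> (y - z) = (A *v z + b) \<bullet> (y - z) + u \<bullet> (A *v (y - z))"
          by (simp add: inner_add_left sym)
        ultimately show ?thesis by linarith
      qed
      then show ?thesis unfolding nodal_subdifferential_def cell[symmetric] by simp
    qed
    have surj: "surj (\<lambda>u. A *v u)"
      using det_pos by (simp add: matrix_right_invertible_surjective[symmetric] invertible_right_inverse[symmetric] invertible_det_nz)
    show ?thesis
    proof
      show "(+) (A *v z + b) ` ((\<lambda>u. A *v u) ` voronoi) \<subseteq> nodal_subdifferential N p\<^sub>h z"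
        using sub by auto
      show "nodal_subdifferential N p\<^sub>h z \<subseteq> (+) (A *v z + b) ` ((\<lambda>u. A *v u) ` voronoi)"
      proof
        fix v assume v: "v \<in> nodal_subdifferential N p\<^sub>h z"
        obtain u where u: "v - (A *v z + b) = A *v u" using surjD[OF surj, of "v - (A *v z + b)"] by blast
        then have "v = A *v z + b + A *v u" by (simp add: algebra_simps)
        then show "v \<in> (+) (A *v z + b) ` ((\<lambda>u. A *v u) ` voronoi)" using sub v by auto
      qed
    qed
  qed
  have lhs: "measure lebesgue (nodal_subdifferential N p\<^sub>h z) = det A * measure lebesgue voronoi"
    unfolding subdiff measure_translation
    using measure_matrix_image[OF lmeasurable_compact[OF compact_voronoi], of A] det_pos
    by simp

  have fin: "finite N" and mesh: "conforming_mesh \<T> N" and zN: "z \<in> N" and hat: "hat_function \<T> N z (\<phi> z)"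
    and size: "node_size \<T> z \<le> h"
    using assms(3,6,11,14) z by (simp_all add: N_def quasi_uniform_def)
  have cont: "continuous_on UNIV (\<phi> z)"
    using hat_function_continuous[OF mesh fin hat zN size assms(8) _ ballT] R3 assms(8)
      mult_strict_right_mono[of 1 R h] by simp
  have nonneg: "0 \<le> \<phi> z x" for x by (rule hat_function_nonneg[OF mesh fin hat zN])
  have [measurable]: "\<phi> z \<in> borel_measurable borel" using cont by (rule borel_measurable_continuous_onI)
  have [measurable]: "voronoi \<in> sets borel" using compact_voronoi by (simp add: borel_compact)
  have "(\<integral>\<^sup>+x. ennreal (\<phi> z x) \<partial>lborel) = (\<integral>\<^sup>+x. ennreal (\<phi> z (x + z)) \<partial>lborel)"
    by (rule nn_integral_lborel_shift[symmetric]) simp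
  also have "\<dots> = (\<integral>\<^sup>+x. indicator voronoi x \<partial>lborel)"
  proof (rule nn_integral_eq_if_tilings[where \<tau> = lat])
    show "AE x in lborel. (\<integral>\<^sup>+k. ennreal (\<phi> z (x - lat k + z)) \<partial>count_space UNIV) = 1"
      using hat_translates_sum_one[OF lattice_basis_axioms assms(6,3) \<Omega>(1) assms(5) N0_lat _ _ assms(15) z far3]
        assms(11,14) ballT ball\<Omega> ball3
      by (simp add: quasi_uniform_def add.commute)
    show "AE x in lborel. (\<integral>\<^sup>+k. indicator voronoi (x + lat k) \<partial>count_space UNIV) = (1::ennreal)"
      by (rule voronoi_tiling)
  qed simp_all
  also have "\<dots> = emeasure lborel voronoi" by simp
  finally have "integral\<^sup>L lborel (\<phi> z) = measure lborel voronoi"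
    using nonneg by (simp add: integral_eq_nn_integral measure_def)
  then have int: "integral\<^sup>L lebesgue (\<phi> z) = measure lebesgue voronoi"
    by (simp add: integral_completion measure_completion)
  \<comment> \<open>The support of the hat function lies in the domain, so integrating over the
    domain or over the whole space is the same.\<close>
  have "\<phi> z x = 0" if "x \<notin> \<Omega>" for x
  proof (rule ccontr)
    assume "\<phi> z x \<noteq> 0"
    then have "dist x z < h" using hat_function_support[OF mesh fin hat zN size assms(8)] by metis
    then have "x \<in> ball z (3 * h)" using assms(8) by (simp add: dist_commute)
    then show False using that ball\<Omega> ball3 by blast
  qed
  then have "indicator \<Omega> x *\<^sub>R (\<phi> z x * det (hessian p x)) = det A * \<phi> z x" for x
    unfolding hess by (cases "x \<in> \<Omega>") auto
  then have "(LINT x:\<Omega>|lebesgue. \<phi> z x * det (hessian p x)) = det A * measure lebesgue voronoi"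
    unfolding set_lebesgue_integral_def by (simp only: integral_mult_right_zero int)
  then show "measure lebesgue (nodal_subdifferential (N0 \<union> Nb) p\<^sub>h z) =
           (LINT x:\<Omega>|lebesgue. \<phi> z x * det (hessian p x))"
    using lhs by (simp add: N_def)
qed

end
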